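(* For every positive integer $n$, the fourth moment (about the mean) of the random variable `size' defined on the set of $(2n+1,2n+3)$-core partitions with distinct parts (with the uniform distribution) is $$ \begin{aligned} \frac{1}{54499737600}\big(&1743712560n^{12}+13490284234n^{11}+45408125279n^{10}+87568584895n^{9}\\ &+109173019890n^{8}+97494786972n^{7}+68082466947n^{6}+34594762895n^{5}\\ &+8734303600n^{4}+3269131844n^{3}+7648567524n^{2}+4135638960n\big). \end{aligned} $$
   Context: A partition is a non-increasing finite sequence $\lambda=(\lambda_1,\dots,\lambda_k)$, $k\ge 0$, of positive integers (the empty partition is allowed); its size is $\lambda_1+\dots+\lambda_k$, and it has distinct parts if the $\lambda_i$ are pairwise distinct. The hook length of a cell $(i,j)$, $1\le j\le\lambda_i$, of its Ferrers (Young) diagram is $\lambda_i-i+\lambda'_j-j+1$, where $\lambda'$ is the conjugate partition. A partition is an $(s,t)$-core partition if none of its hook lengths equals $s$ and none equals $t$. For $s=2n+1$, $t=2n+3$ (relatively prime) the set of $(s,t)$-core partitions is finite. If $Q_n$ is the finite set of $(2n+1,2n+3)$-core partitions with distinct parts and $\mu_n=\frac{1}{|Q_n|}\sum_{\lambda\in Q_n}\mathrm{size}(\lambda)$, the $k$-th moment about the mean is $\frac{1}{|Q_n|}\sum_{\lambda\in Q_n}(\mathrm{size}(\lambda)-\mu_n)^k$. *)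

theory Defs
  imports Complex_Main
begin

definition is_partition :: "nat list \<Rightarrow> bool" where
  "is_partition xs \<longleftrightarrow> sorted_wrt (\<ge>) xs \<and> (\<forall>p\<in>set xs. p > 0)"

(* Parts are numbered from 1, as are rows and columns below. *)
definition part :: "nat list \<Rightarrow> nat \<Rightarrow> nat" where
  "part xs i = xs ! (i - 1)"

definition cells :: "nat list \<Rightarrow> (nat \<times> nat) set" where
  "cells xs = {(i, j). 1 \<le> i \<and> i \<le> length xs \<and> 1 \<le> j \<and> j \<le> part xs i}"

definition conjugate :: "nat list \<Rightarrow> nat list" where
  "conjugate xs =
     (case xs of [] \<Rightarrow> []
      | x # _ \<Rightarrow> map (\<lambda>j. length (filter (\<lambda>p. p \<ge> j) xs)) [1..<Suc x])"

(* Integer-valued because intermediate differences such as part xs i - i may be negative. *)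
definition hook_length :: "nat list \<Rightarrow> nat \<Rightarrow> nat \<Rightarrow> int" where
  "hook_length xs i j =
     int (part xs i) - int i + int (part (conjugate xs) j) - int j + 1"

definition is_core :: "nat \<Rightarrow> nat \<Rightarrow> nat list \<Rightarrow> bool" where
  "is_core s t xs \<longleftrightarrow> is_partition xs \<and>
     (\<forall>(i, j)\<in>cells xs. hook_length xs i j \<noteq> int s \<and> hook_length xs i j \<noteq> int t)"

definition distinct_cores :: "nat \<Rightarrow> nat \<Rightarrow> nat list set" where
  "distinct_cores s t = {xs. is_core s t xs \<and> distinct xs}"

definition mean_on :: "'a set \<Rightarrow> ('a \<Rightarrow> real) \<Rightarrow> real" where
  "mean_on A f = (1 / real (card A)) * (\<Sum>x\<in>A. f x)"

definition central_moment :: "nat \<Rightarrow> 'a set \<Rightarrow> ('a \<Rightarrow> real) \<Rightarrow> real" where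
  "central_moment k A f = (1 / real (card A)) * (\<Sum>x\<in>A. (f x - mean_on A f) ^ k)"

lemma cells_conjugate:
  assumes "is_partition xs"
  shows "(i, j) \<in> cells (conjugate xs) \<longleftrightarrow> (j, i) \<in> cells xs"
proof -
  have le_filter: "j \<le> length (filter (\<lambda>p. p \<ge> i) xs) \<longleftrightarrow> j \<le> length xs \<and> i \<le> xs ! (j - 1)"
    if "sorted_wrt (\<ge>) xs" "1 \<le> j" for xs :: "nat list" and i j
    using that
  proof (induction xs arbitrary: j)
    case Nil
    then show ?case by simp
  next
    case (Cons x xs)
    show ?case
    proof (cases "j = 1")
      case True
      then show ?thesis
        using Cons.prems(1) by (auto simp: Suc_le_eq filter_empty_conv)
    next
      case False
      then obtain m where m: "j = Suc (Suc m)"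
        using Cons.prems(2) by (intro that[of "j - 2"]) simp
      have IH: "Suc m \<le> length (filter (\<lambda>p. p \<ge> i) xs) \<longleftrightarrow> Suc m \<le> length xs \<and> i \<le> xs ! m"
        using Cons.IH[of "Suc m"] Cons.prems(1) by simp
      show ?thesis
      proof (cases "x \<ge> i")
        case True
        then show ?thesis using IH m by simp
      next
        case False
        then have "filter (\<lambda>p. p \<ge> i) xs = []"
          using Cons.prems(1) by (auto simp: filter_empty_conv)
        moreover have "\<not> i \<le> xs ! m" if "m < length xs"
          using False Cons.prems(1) nth_mem[OF that] by fastforce
        ultimately show ?thesis using False m by auto
      qed
    qed
  qed
  show ?thesis
  proof (cases xs)
    case Nil
    then show ?thesis by (auto simp: cells_def conjugate_def)
  next
    case (Cons x ys)
    have srt: "sorted_wrt (\<ge>) xs" using assms by (simp add: is_partition_def)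
    have len: "length (conjugate xs) = x" by (simp add: conjugate_def Cons del: upt_Suc)
    have nth: "part (conjugate xs) i = length (filter (\<lambda>p. p \<ge> i) xs)" if "1 \<le> i" "i \<le> x"
      using that nth_upt[of 1 "i - 1" "Suc x"] by (simp add: conjugate_def Cons part_def del: upt_Suc filter.simps)
    have le_x: "xs ! (j - 1) \<le> x" if "1 \<le> j" "j \<le> length xs"
    proof -
      have "xs ! (j - 1) \<in> set xs" using that by simp
      then show ?thesis using srt Cons by auto
    qed
    have "(i, j) \<in> cells (conjugate xs) \<longleftrightarrow>
        1 \<le> i \<and> i \<le> x \<and> 1 \<le> j \<and> j \<le> length (filter (\<lambda>p. p \<ge> i) xs)"
      unfolding cells_def len using nth by auto
    also have "\<dots> \<longleftrightarrow> 1 \<le> i \<and> i \<le> x \<and> 1 \<le> j \<and> j \<le> length xs \<and> i \<le> xs ! (j - 1)"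
      using le_filter[OF srt] by metis
    also have "\<dots> \<longleftrightarrow> (j, i) \<in> cells xs"
      unfolding cells_def part_def using le_x by (auto intro: order_trans)
    finally show ?thesis .
  qed
qed

end

theory Submission
  imports Defs "HOL-Computational_Algebra.Formal_Power_Series"
begin

text \<open>A partition is encoded by its beta set, the set of hook lengths in its first column.  Hook lengths
\<open>s\<close> are absent exactly if this set is closed under subtracting \<open>s\<close>, and the parts are distinct exactly
if it contains no two consecutive numbers.  For \<open>s = 2n+1\<close> and \<open>t = s+2\<close> put the beta set on an abacus
with \<open>s\<close> runners: a core is then a list of bead counts \<open>a\<^sub>0, ..., a\<^sub>2\<^sub>n\<close> with \<open>a\<^sub>0 = 0\<close>, no two
neighbouring positive entries, \<open>a\<^sub>r\<^sub>+\<^sub>2 \<le> a\<^sub>r + 1\<close>, and the wrap-around condition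
\<open>a\<^sub>1 \<le> a\<^sub>2\<^sub>n + 2\<close>.  The size of the core is the sum over all pairs \<open>q < r\<close> of
\<open>(a\<^sub>r - a\<^sub>q) (a\<^sub>r - a\<^sub>q + 1) / 2\<close>.  This sum does not change when the
last entry \<open>a\<close> is moved to the front and becomes \<open>a + 1\<close>.
Rotating the list in this way removes the wrap-around condition and leaves linear words that are read
from left to right with one bounded parameter (\<open>sum_distinct_cores\<close>, \<open>sum_abacus\<close>).

Let \<open>g\<close> be the bound on the next positive letter.  Separating the words whose first block attains the bound
gives, for the generating functions \<open>F\<^sub>g\<close> of the words, equations
\<open>F\<^sub>g\<^sub>+\<^sub>1 - F\<^sub>g = x F\<^sub>g\<^sub>+\<^sub>2\<close>, solved by the powers of the Catalan series \<open>C = 1 + x C\<^sup>2\<close>.  If the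
words are weighted by a monomial in the size, the sum of the letters and the sum of their binomial
coefficients over 2, the same equation holds with a source term built from monomials of lower weight, and the
solution is \<open>C\<^sup>g P(g)\<close> where \<open>P\<close> is a polynomial in \<open>g\<close> and in \<open>y = (C - 1) / (2 - C)\<close>.  In the basis of
binomial coefficients of \<open>g\<close> every step of this recursion is an integer linear operation on coefficient
lists; \<open>tabEO_correct\<close> proves the recursion correct, and term rewriting evaluates it.

Hence the generating function of the sums of \<open>q\<close>-th powers of the sizes is \<open>C\<^sup>2 N\<^sub>q(y)\<close> for an explicit
polynomial.  Each \<open>N\<^sub>q(y)\<close> turns out to be \<open>(1 + y)\<^sup>2 M\<^sub>q(y + y\<^sup>2)\<close>, while
\<open>C\<^sup>2 (1 + y)\<^sup>2 = 1 / (1 - 4x)\<close> and \<open>y + y\<^sup>2 = x / (1 - 4x)\<close>.  The coefficient of \<open>x\<^sup>n\<close> is therefore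
\<open>4\<^sup>n\<close> times a polynomial in \<open>n\<close>, written in Newton form.  For \<open>q = 0\<close> it is \<open>4\<^sup>n\<close>, the number of cores, so
these polynomials are the moments about the origin, and the fourth central moment is a polynomial in them.\<close>

section \<open>Hook lengths and beta sets\<close>

text \<open>Row \<open>i\<close> of a partition with \<open>k\<close> rows contributes its first-column hook length
\<open>\<lambda>\<^sub>i + (k - i)\<close>.\<close>

definition beta :: "nat list \<Rightarrow> nat set" where
  "beta xs = (\<lambda>i. part xs i + (length xs - i)) ` {1..length xs}"

lemma beta_Nil [simp]: "beta [] = {}" by (simp add: beta_def)

lemma beta_Cons: "beta (x # xs) = insert (x + length xs) (beta xs)"
proof -
  have "{1..length (x # xs)} = insert 1 (Suc ` {1..length xs})"
    by (simp add: image_Suc_atLeastAtMost atLeastAtMost_insertL)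
  moreover have "(\<lambda>i. part (x # xs) i + (length (x # xs) - i)) ` Suc ` {1..length xs} = beta xs"
    unfolding beta_def image_image by (rule image_cong) (auto simp: Defs.part_def nth_Cons')
  ultimately show ?thesis
    by (simp only: beta_def image_insert) (simp add: Defs.part_def)
qed

lemma is_partition_Cons:
  "is_partition (x # xs) \<longleftrightarrow> is_partition xs \<and> 0 < x \<and> (\<forall>y\<in>set xs. y \<le> x)"
  by (auto simp: is_partition_def)

lemma beta_less:
  assumes "\<forall>y\<in>set xs. y \<le> x" "b \<in> beta xs" shows "b < x + length xs"
proof -
  obtain i where i: "i \<in> {1..length xs}" "b = part xs i + (length xs - i)"
    using assms(2) by (auto simp: beta_def)
  then have "i - 1 < length xs" by auto
  then have "part xs i \<in> set xs" unfolding Defs.part_def by (rule nth_mem)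
  then show ?thesis using assms(1) i by fastforce
qed

lemma beta_Cons_less: "is_partition (x # xs) \<Longrightarrow> b \<in> beta xs \<Longrightarrow> b < x + length xs"
  by (rule beta_less) (simp_all add: is_partition_Cons)

lemma finite_beta [simp]: "finite (beta xs)" by (simp add: beta_def)

lemma card_beta: "is_partition xs \<Longrightarrow> card (beta xs) = length xs"
proof (induction xs)
  case (Cons x xs)
  have "x + length xs \<notin> beta xs" using beta_Cons_less[OF Cons.prems] by blast
  then show ?case using Cons by (simp add: beta_Cons is_partition_Cons)
qed simp

text \<open>A diagram with \<open>k\<close> rows and no cells would have the beta set \<open>{0, ..., k - 1}\<close>, and every cell raises the
sum by one.\<close>

lemma sum_beta: "is_partition xs \<Longrightarrow> real (\<Sum>(beta xs)) = real (sum_list xs) + real (length xs) * (real (length xs) - 1) / 2"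
proof (induction xs)
  case (Cons x xs)
  have "x + length xs \<notin> beta xs" using beta_Cons_less[OF Cons.prems] by blast
  then show ?case using Cons by (simp add: beta_Cons is_partition_Cons field_simps)
qed simp

lemma zero_notin_beta: "is_partition xs \<Longrightarrow> 0 \<notin> beta xs"
  by (induction xs) (auto simp: beta_Cons is_partition_Cons)

lemma inj_on_beta: "inj_on beta {xs. is_partition xs}"
proof (rule inj_onI)
  fix xs ys :: "nat list"
  assume "xs \<in> {xs. is_partition xs}" "ys \<in> {xs. is_partition xs}" and e: "beta xs = beta ys"
  then have "is_partition xs" "is_partition ys" by simp_all
  then show "xs = ys" using e
  proof (induction xs arbitrary: ys)
    case Nil
    from card_beta[OF Nil.prems(2)] have "length ys = card (beta ([] :: nat list))"
      unfolding Nil.prems(3) by (rule sym)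
    then show ?case by simp
  next
    case (Cons x xs)
    have px: "is_partition xs" using Cons.prems(1) by (simp add: is_partition_Cons)
    have "length (x # xs) = length ys"
      using card_beta[OF Cons.prems(1)] card_beta[OF Cons.prems(2)] by (simp only: Cons.prems(3))
    then obtain y zs where ys: "ys = y # zs" and len: "length zs = length xs" by (cases ys) auto
    have py: "is_partition (y # zs)" using Cons.prems(2) ys by simp
    have lx: "\<And>b. b \<in> beta xs \<Longrightarrow> b < x + length xs" by (rule beta_Cons_less[OF Cons.prems(1)])
    have lz: "\<And>b. b \<in> beta zs \<Longrightarrow> b < y + length zs" by (rule beta_Cons_less[OF py])
    have mx: "Max (insert (x + length xs) (beta xs)) = x + length xs"
      by (rule Max_eqI) (auto dest!: lx)
    have my: "Max (insert (y + length zs) (beta zs)) = y + length zs"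
      by (rule Max_eqI) (auto dest!: lz)
    have ins: "insert (x + length xs) (beta xs) = insert (y + length zs) (beta zs)"
      using Cons.prems(3) by (simp only: beta_Cons ys)
    have eq: "x + length xs = y + length zs" by (metis mx my ins)
    have "beta xs = insert (x + length xs) (beta xs) - {x + length xs}" using lx by blast
    also have "\<dots> = insert (y + length zs) (beta zs) - {y + length zs}" by (simp only: ins[unfolded eq] eq)
    also have "\<dots> = beta zs" using lz by blast
    finally have "xs = zs" using py by (intro Cons.IH px) (simp_all add: is_partition_Cons)
    then show ?case using eq ys by simp
  qed
qed

text \<open>Reading a finite set from its largest element downwards yields the parts; each part is the number of
missing values below the element, so positivity of the last part is the condition that 0 is missing.\<close>

lemma beta_surj:
  assumes "finite B" "0 \<notin> B"
  shows "\<exists>xs. is_partition xs \<and> beta xs = B"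
  using assms
proof (induction B rule: finite_linorder_max_induct)
  case empty
  then show ?case by (intro exI[of _ "[]"]) (simp add: is_partition_def)
next
  case (insert M A)
  then obtain xs where xs: "is_partition xs" "beta xs = A" by auto
  have bound: "y + length xs \<le> M" if "y \<in> set xs" for y
  proof -
    obtain z zs where z: "xs = z # zs" using \<open>y \<in> set xs\<close> by (cases xs) auto
    have "z + length zs \<in> A" using xs(2) z by (auto simp: beta_Cons)
    then have "z + length zs < M" using insert.hyps by auto
    moreover have "y \<le> z" using xs(1) that z by (auto simp: is_partition_Cons)
    ultimately show ?thesis using z by simp
  qed
  have "length xs < M"
  proof (cases xs)
    case Nil then show ?thesis using insert.prems by auto
  next
    case (Cons z zs) then show ?thesis using bound[of z] xs(1) by (auto simp: is_partition_Cons)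
  qed
  then have "is_partition ((M - length xs) # xs)" "beta ((M - length xs) # xs) = insert M A"
    using xs bound by (auto simp: is_partition_Cons beta_Cons le_diff_conv2)
  then show ?case by blast
qed

text \<open>Passing from one row to the next lowers the beta number by one more than the difference of the parts.\<close>

lemma distinct_iff_beta:
  "is_partition xs \<Longrightarrow> distinct xs \<longleftrightarrow> (\<forall>b\<in>beta xs. Suc b \<notin> beta xs)"
proof (induction xs)
  case (Cons x xs)
  have less: "b < x + length xs" if "b \<in> beta xs" for b
    using beta_Cons_less[OF Cons.prems that] .
  have "x \<in> set xs \<longleftrightarrow> x + length xs - 1 \<in> beta xs \<and> xs \<noteq> []"
  proof (cases xs)
    case (Cons y ys)
    have yx: "y \<le> x" and le: "\<forall>z\<in>set ys. z \<le> y" using Cons.prems Cons by (auto simp: is_partition_Cons)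
    have "x \<in> set xs \<longleftrightarrow> x = y" using yx le Cons by auto
    also have "\<dots> \<longleftrightarrow> x + length xs - 1 \<in> beta xs"
      using yx Cons beta_less[OF le] by (auto simp: beta_Cons) fastforce
    finally show ?thesis using Cons by simp
  qed simp
  moreover have "(\<forall>b\<in>beta (x # xs). Suc b \<notin> beta (x # xs)) \<longleftrightarrow>
      \<not> (x + length xs - 1 \<in> beta xs \<and> xs \<noteq> []) \<and> (\<forall>b\<in>beta xs. Suc b \<notin> beta xs)"
  proof -
    have "Suc (x + length xs) \<notin> beta xs" using less by fastforce
    moreover have "(\<exists>b\<in>beta xs. Suc b = x + length xs) \<longleftrightarrow> x + length xs - 1 \<in> beta xs \<and> xs \<noteq> []"
    proof (cases "xs = []")
      case False
      then have "Suc (x + length xs - 1) = x + length xs" by (cases xs) simp_all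
      then have "Suc b = x + length xs \<longleftrightarrow> b = x + length xs - 1" for b by auto
      then show ?thesis using False by auto
    qed simp
    ultimately show ?thesis by (auto simp: beta_Cons)
  qed
  ultimately show ?case using Cons by (simp add: is_partition_Cons)
qed simp

lemma part_antimono:
  assumes "is_partition xs" "1 \<le> i" "i \<le> j" "j \<le> length xs"
  shows "part xs j \<le> part xs i"
proof (cases "i = j")
  case False
  then show ?thesis using assms sorted_wrt_nth_less[of "(\<ge>)" xs "i - 1" "j - 1"]
    by (simp add: is_partition_def Defs.part_def)
qed simp

lemma column_iff:
  assumes "is_partition xs" "(i, j) \<in> cells xs" "1 \<le> k"
  shows "k \<le> part (conjugate xs) j \<longleftrightarrow> (k, j) \<in> cells xs"
proof -
  have "(j, i) \<in> cells (conjugate xs)" using assms cells_conjugate by blast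
  then have "k \<le> part (conjugate xs) j \<longleftrightarrow> (j, k) \<in> cells (conjugate xs)"
    using assms(3) by (auto simp: cells_def)
  then show ?thesis using cells_conjugate[OF assms(1)] by simp
qed

text \<open>Removing a rim hook of length \<open>s\<close> from row \<open>i\<close> moves the beta number \<open>b\<close> of that row to the free place
\<open>b - s\<close>.  Concretely, a free place \<open>c\<close> below \<open>b\<close> determines a column: if \<open>q\<close> is the last row whose beta
number exceeds \<open>c\<close>, then the column \<open>j = c - (k - q) + 1\<close> has height \<open>q\<close>, and the hook of \<open>(i, j)\<close> has length
\<open>b - c\<close>.\<close>

lemma hook_length_iff:
  assumes p: "is_partition xs" and s: "0 < s"
  shows "(\<exists>(i, j)\<in>cells xs. hook_length xs i j = int s) \<longleftrightarrow> (\<exists>b\<in>beta xs. s \<le> b \<and> b - s \<notin> beta xs)"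
proof
  assume "\<exists>(i, j)\<in>cells xs. hook_length xs i j = int s"
  then obtain i j where ij: "(i, j) \<in> cells xs" "hook_length xs i j = int s" by auto
  let ?k = "length xs" and ?q = "part (conjugate xs) j"
  have i: "1 \<le> i" "i \<le> ?k" "1 \<le> j" "j \<le> part xs i" using ij(1) by (auto simp: cells_def)
  have col: "m \<le> ?q \<longleftrightarrow> m \<le> ?k \<and> j \<le> part xs m" if "1 \<le> m" for m
    using column_iff[OF p ij(1) that] that i(3) by (auto simp: cells_def)
  have qk: "?q \<le> ?k" using col[of ?q] by (cases "?q = 0") auto
  let ?b = "part xs i + (?k - i)"
  have c: "int ?b - int s = int ?k - int ?q + int j - 1"
    using ij(2) i(2) by (simp add: hook_length_def of_nat_diff)
  then have sb: "s \<le> ?b" using qk i(3) by linarith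
  moreover have "?b - s \<notin> beta xs"
  proof
    assume "?b - s \<in> beta xs"
    then obtain m where m: "1 \<le> m" "m \<le> ?k" "?b - s = part xs m + (?k - m)" by (auto simp: beta_def)
    then have "int (part xs m) - int m = int j - 1 - int ?q"
      using c sb by (simp add: of_nat_diff)
    then show False using col[OF m(1)] m(2) by (cases "m \<le> ?q") auto
  qed
  moreover have "?b \<in> beta xs" using i by (auto simp: beta_def)
  ultimately show "\<exists>b\<in>beta xs. s \<le> b \<and> b - s \<notin> beta xs" by blast
next
  assume "\<exists>b\<in>beta xs. s \<le> b \<and> b - s \<notin> beta xs"
  then obtain i where i: "1 \<le> i" "i \<le> length xs" and sb: "s \<le> part xs i + (length xs - i)"
    and nb: "part xs i + (length xs - i) - s \<notin> beta xs" by (auto simp: beta_def)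
  let ?k = "length xs"
  define bt where "bt m = part xs m + (?k - m)" for m
  define c where "c = bt i - s"
  have bt_in: "bt m \<in> beta xs" if "1 \<le> m" "m \<le> ?k" for m using that by (auto simp: beta_def bt_def)
  define P where "P = {m. 1 \<le> m \<and> m \<le> ?k \<and> c < bt m}"
  have finP: "finite P" unfolding P_def by (rule finite_subset[of _ "{..?k}"]) auto
  have iP: "i \<in> P" using i sb s by (auto simp: P_def c_def bt_def)
  (* the last row whose beta number exceeds the free place; its index is the height of the column sought *)
  define q where "q = Max P"
  have q: "1 \<le> q" "q \<le> ?k" "c < bt q" "i \<le> q"
  proof -
    have "q \<in> P" unfolding q_def using Max_in[OF finP] iP by blast
    then show "1 \<le> q" "q \<le> ?k" "c < bt q" by (simp_all add: P_def)
    show "i \<le> q" unfolding q_def by (rule Max_ge[OF finP iP])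
  qed
  have next_row: "bt (Suc q) < c" if "Suc q \<le> ?k"
  proof -
    have "Suc q \<notin> P" using Max_ge[OF finP, of "Suc q"] by (auto simp: q_def)
    then have "bt (Suc q) \<le> c" using that by (simp add: P_def)
    moreover have "bt (Suc q) \<noteq> c" using nb bt_in[of "Suc q"] that by (auto simp: c_def bt_def)
    ultimately show ?thesis by simp
  qed
  have ck: "?k - q \<le> c"
  proof (cases "Suc q \<le> ?k")
    case True
    then have "0 < part xs (Suc q)" using p by (auto simp: is_partition_def Defs.part_def)
    then show ?thesis using next_row[OF True] True by (simp add: bt_def)
  qed simp
  define j where "j = c - (?k - q) + 1"
  have jq: "j \<le> part xs q" using q ck by (simp add: j_def bt_def)
  have ji: "j \<le> part xs i" using jq part_antimono[OF p i(1) q(4) q(2)] by simp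
  have ij: "(i, j) \<in> cells xs" using i ji by (simp add: cells_def j_def)
  have "q \<le> part (conjugate xs) j"
    using column_iff[OF p ij q(1)] q jq by (simp add: cells_def j_def)
  moreover have "\<not> Suc q \<le> part (conjugate xs) j"
  proof
    assume "Suc q \<le> part (conjugate xs) j"
    then have "(Suc q, j) \<in> cells xs" using column_iff[OF p ij, of "Suc q"] by simp
    then have "Suc q \<le> ?k" "j \<le> part xs (Suc q)" by (auto simp: cells_def)
    then show False using next_row ck by (simp add: j_def bt_def)
  qed
  ultimately have conj: "part (conjugate xs) j = q" by simp
  have "hook_length xs i j = int (part xs i) - int i + int q - int j + 1"
    by (simp add: hook_length_def conj)
  also have "\<dots> = int s"
    using i q ck sb by (simp add: j_def c_def bt_def of_nat_diff)
  finally show "\<exists>(i, j)\<in>cells xs. hook_length xs i j = int s" using ij by auto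
qed

text \<open>The beta sets of cores with distinct parts: the closure conditions exclude hooks of length \<open>s\<close> and \<open>t\<close>, the
last condition excludes equal parts.\<close>

definition core_beads :: "nat \<Rightarrow> nat \<Rightarrow> nat set set" where
  "core_beads s t = {B. finite B \<and> 0 \<notin> B \<and> (\<forall>b\<in>B. s \<le> b \<longrightarrow> b - s \<in> B) \<and> (\<forall>b\<in>B. t \<le> b \<longrightarrow> b - t \<in> B)
     \<and> (\<forall>b\<in>B. Suc b \<notin> B)}"

lemma bij_betw_beta:
  assumes "0 < s" "0 < t"
  shows "bij_betw beta (distinct_cores s t) (core_beads s t)"
proof -
  have iff: "xs \<in> distinct_cores s t \<longleftrightarrow> is_partition xs \<and> beta xs \<in> core_beads s t" for xs
  proof (cases "is_partition xs")
    case True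
    have "(\<forall>(i, j)\<in>cells xs. hook_length xs i j \<noteq> int s \<and> hook_length xs i j \<noteq> int t) \<longleftrightarrow>
        \<not> (\<exists>(i, j)\<in>cells xs. hook_length xs i j = int s) \<and> \<not> (\<exists>(i, j)\<in>cells xs. hook_length xs i j = int t)"
      by auto
    then show ?thesis
      using True hook_length_iff[OF True assms(1)] hook_length_iff[OF True assms(2)]
        distinct_iff_beta[OF True] zero_notin_beta[OF True]
      by (auto simp: distinct_cores_def is_core_def core_beads_def)
  qed (simp add: distinct_cores_def is_core_def)
  show ?thesis
  proof (rule bij_betw_imageI)
    show "inj_on beta (distinct_cores s t)"
      by (rule inj_on_subset[OF inj_on_beta]) (auto simp: iff)
    show "beta ` distinct_cores s t = core_beads s t"
    proof (intro equalityI subsetI)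
      fix B assume B: "B \<in> core_beads s t"
      then obtain xs where "is_partition xs" "beta xs = B"
        using beta_surj[of B] by (auto simp: core_beads_def)
      then show "B \<in> beta ` distinct_cores s t" using B iff by blast
    qed (auto simp: iff)
  qed
qed

section \<open>Cores with distinct parts on an abacus\<close>

text \<open>Position \<open>r + s q\<close> is place \<open>q\<close> of runner \<open>r\<close>.  The beads of every runner are pushed down to its lowest
places, as closure under subtracting \<open>s\<close> demands, so their number describes the runner.\<close>

definition beads :: "nat \<Rightarrow> nat list \<Rightarrow> nat set" where
  "beads s as = {x. x div s < as ! (x mod s)}"

text \<open>The last two conditions express closure under subtracting \<open>s + 2\<close>: that moves a bead two runners to the left
and one place down, except on runner 1, from where it goes to runner \<open>s - 1\<close> two places down.\<close>

definition abacus :: "nat \<Rightarrow> nat list set" where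
  "abacus s = {as. length as = s \<and> as ! 0 = 0
     \<and> (\<forall>r. Suc r < s \<longrightarrow> as ! r = 0 \<or> as ! Suc r = 0)
     \<and> (\<forall>r. r + 2 < s \<longrightarrow> as ! (r + 2) \<le> as ! r + 1)
     \<and> as ! 1 \<le> as ! (s - 1) + 2}"

lemma beads_runner: "r < s \<Longrightarrow> r + s * q \<in> beads s as \<longleftrightarrow> q < as ! r"
  by (simp add: beads_def)

lemma bij_betw_beads_positions:
  assumes "0 < s"
  shows "bij_betw (\<lambda>(r, q). r + s * q) (SIGMA r:{..<s}. {..<as ! r}) (beads s as)"
proof (rule bij_betw_byWitness[where f' = "\<lambda>x. (x mod s, x div s)"])
  show "(\<lambda>(r, q). r + s * q) ` (SIGMA r:{..<s}. {..<as ! r}) \<subseteq> beads s as"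
    by (auto simp: beads_runner)
  show "(\<lambda>x. (x mod s, x div s)) ` beads s as \<subseteq> (SIGMA r:{..<s}. {..<as ! r})"
    using assms by (auto simp: beads_def)
qed auto

lemma sum_beads:
  fixes f :: "nat \<Rightarrow> 'b::comm_monoid_add"
  assumes "0 < s"
  shows "(\<Sum>x\<in>beads s as. f x) = (\<Sum>r<s. \<Sum>q<as ! r. f (r + s * q))"
proof -
  have "(\<Sum>x\<in>beads s as. f x) = (\<Sum>p\<in>(SIGMA r:{..<s}. {..<as ! r}). f ((\<lambda>(r, q). r + s * q) p))"
    by (rule sum.reindex_bij_betw[OF bij_betw_beads_positions[OF assms], symmetric])
  also have "\<dots> = (\<Sum>r<s. \<Sum>q<as ! r. f (r + s * q))"
    by (subst sum.Sigma) (auto intro!: sum.cong)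
  finally show ?thesis .
qed

lemma finite_beads: "0 < s \<Longrightarrow> finite (beads s as)"
  using bij_betw_finite[OF bij_betw_beads_positions] by (auto intro!: finite_SigmaI)

lemma beads_core_iff:
  assumes len: "length as = s" and s: "3 \<le> s"
  shows "beads s as \<in> core_beads s (s + 2) \<longleftrightarrow> as \<in> abacus s"
proof
  assume B: "beads s as \<in> core_beads s (s + 2)"
  have z: "as ! 0 = 0" using B s beads_runner[of 0 s 0 as] by (auto simp: core_beads_def)
  moreover have "as ! r = 0 \<or> as ! Suc r = 0" if "Suc r < s" for r
    using B that beads_runner[of r s 0 as] beads_runner[of "Suc r" s 0 as] by (auto simp: core_beads_def)
  moreover have "as ! (r + 2) \<le> as ! r + 1" if "r + 2 < s" for r
  proof (rule ccontr)
    assume "\<not> ?thesis"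
    then have "(r + 2) + s * (as ! r + 1) \<in> beads s as" using that by (subst beads_runner) auto
    then have "(r + 2) + s * (as ! r + 1) - (s + 2) \<in> beads s as" using B by (auto simp: core_beads_def)
    moreover have "(r + 2) + s * (as ! r + 1) - (s + 2) = r + s * (as ! r)" by simp
    ultimately have "r + s * (as ! r) \<in> beads s as" by simp
    then show False using that by (subst (asm) beads_runner) auto
  qed
  moreover have "as ! 1 \<le> as ! (s - 1) + 2"
  proof (rule ccontr)
    assume "\<not> ?thesis"
    then have "1 + s * (as ! (s - 1) + 2) \<in> beads s as" using s by (subst beads_runner) auto
    moreover have "s + 2 \<le> 1 + s * (as ! (s - 1) + 2)" using s by (simp add: algebra_simps)
    ultimately have "1 + s * (as ! (s - 1) + 2) - (s + 2) \<in> beads s as" using B by (auto simp: core_beads_def)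
    moreover have "1 + s * (as ! (s - 1) + 2) - (s + 2) = (s - 1) + s * (as ! (s - 1))"
      using s by (simp add: algebra_simps)
    ultimately have "(s - 1) + s * (as ! (s - 1)) \<in> beads s as" by simp
    then show False using s by (subst (asm) beads_runner) auto
  qed
  ultimately show "as \<in> abacus s" using len by (simp add: abacus_def)
next
  assume A: "as \<in> abacus s"
  then have z: "as ! 0 = 0" and adj: "\<And>r. Suc r < s \<Longrightarrow> as ! r = 0 \<or> as ! Suc r = 0"
    and two: "\<And>r. r + 2 < s \<Longrightarrow> as ! (r + 2) \<le> as ! r + 1" and last: "as ! 1 \<le> as ! (s - 1) + 2"
    by (simp_all add: abacus_def)
  let ?B = "beads s as"
  have split: "\<exists>r q. r < s \<and> q < as ! r \<and> x = r + s * q" if "x \<in> ?B" for x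
    using that s by (intro exI[of _ "x mod s"] exI[of _ "x div s"]) (auto simp: beads_def)
  have "b - s \<in> ?B" if b: "b \<in> ?B" "s \<le> b" for b
  proof -
    obtain r q where q: "r < s" "q < as ! r" "b = r + s * q" using split b by blast
    then obtain p where "q = Suc p" using b(2) by (cases q) auto
    then have "b - s = r + s * p" "p < as ! r" using q by auto
    then show ?thesis using q(1) by (simp only: beads_runner)
  qed
  moreover have "b - (s + 2) \<in> ?B" if b: "b \<in> ?B" "s + 2 \<le> b" for b
  proof -
    obtain r q where q: "r < s" "q < as ! r" "b = r + s * q" using split b by blast
    then obtain p where p: "q = Suc p" using b(2) by (cases q) auto
    consider "r = 0" | "r = 1" | r' where "r = r' + 2"
      by (metis One_nat_def Suc_1 add_2_eq_Suc' old.nat.exhaust)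
    then show ?thesis
    proof cases
      case 1 then show ?thesis using q z by simp
    next
      case 2
      then obtain p' where p': "p = Suc p'" using b(2) q p by (cases p) auto
      have "b - (s + 2) = (s - 1) + s * p'" using 2 q p p' s by (simp add: algebra_simps)
      moreover have "p' < as ! (s - 1)" using last 2 q p p' by simp
      ultimately show ?thesis using s beads_runner[of "s - 1" s p' as] by simp
    next
      case 3
      have "b - (s + 2) = r' + s * p" using 3 q p by simp
      moreover have "p < as ! r'" using two[of r'] 3 q p by simp
      ultimately show ?thesis using 3 q(1) beads_runner[of r' s p as] by simp
    qed
  qed
  moreover have "Suc b \<notin> ?B" if b: "b \<in> ?B" for b
  proof -
    obtain r q where q: "r < s" "q < as ! r" "b = r + s * q" using split b by blast
    show ?thesis
    proof (cases "Suc r < s")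
      case True
      then have "as ! Suc r = 0" using adj[OF True] q by auto
      then show ?thesis using q beads_runner[OF True, of q as] by simp
    next
      case False
      then have "Suc b = 0 + s * Suc q" using q by simp
      moreover have "0 + s * Suc q \<notin> ?B" using z s by (subst beads_runner) auto
      ultimately show ?thesis by simp
    qed
  qed
  moreover have "0 \<notin> ?B" using z by (simp add: beads_def)
  ultimately show "?B \<in> core_beads s (s + 2)" using s by (simp add: core_beads_def finite_beads)
qed

lemma bij_betw_beads:
  assumes s: "3 \<le> s"
  shows "bij_betw (beads s) (abacus s) (core_beads s (s + 2))"
proof (rule bij_betw_imageI)
  show "inj_on (beads s) (abacus s)"
  proof (rule inj_onI)
    fix as bs assume A: "as \<in> abacus s" "bs \<in> abacus s" and e: "beads s as = beads s bs"
    have "as ! r = bs ! r" if "r < s" for r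
    proof -
      have "q < as ! r \<longleftrightarrow> q < bs ! r" for q using e that beads_runner by metis
      then show ?thesis by (metis linorder_neqE_nat less_irrefl)
    qed
    then show "as = bs" using A by (intro nth_equalityI) (auto simp: abacus_def)
  qed
  show "beads s ` abacus s = core_beads s (s + 2)"
  proof (intro equalityI subsetI)
    fix B assume B: "B \<in> core_beads s (s + 2)"
    then have fin: "finite B" and down: "\<And>b. b \<in> B \<Longrightarrow> s \<le> b \<Longrightarrow> b - s \<in> B"
      by (auto simp: core_beads_def)
    define as where "as = map (\<lambda>r. card {q. r + s * q \<in> B}) [0..<s]"
    have run: "r + s * q \<in> B \<longleftrightarrow> q < card {q. r + s * q \<in> B}" for r q
    proof -
      let ?Q = "{q. r + s * q \<in> B}"
      have "inj (\<lambda>q. r + s * q)" using s by (auto intro!: injI)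
      then have finQ: "finite ?Q" using finite_vimageI[OF fin] by (simp add: vimage_def)
      have dn: "p \<in> ?Q" if "Suc p \<in> ?Q" for p using down[of "r + s * Suc p"] that by simp
      have dn_closed: "p \<in> ?Q" if "p \<le> p'" "p' \<in> ?Q" for p p'
        using that
      proof (induction rule: inc_induct)
        case (step m)
        then show ?case using dn[of m] by simp
      qed
      obtain m where m: "m \<notin> ?Q" using finQ by (metis finite_nat_set_iff_bounded less_irrefl)
      define k where "k = (LEAST m. m \<notin> ?Q)"
      have "k \<notin> ?Q" unfolding k_def using m by (rule LeastI)
      moreover have "p \<in> ?Q" if "p < k" for p using not_less_Least that unfolding k_def by blast
      ultimately have "p \<in> ?Q \<longleftrightarrow> p < k" for p using dn_closed[of k p] by (cases "p < k") auto
      then have "?Q = {..<k}" by blast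
      then have "q \<in> ?Q \<longleftrightarrow> q < card ?Q" by (metis card_lessThan lessThan_iff)
      then show ?thesis by simp
    qed
    have "x \<in> beads s as \<longleftrightarrow> x \<in> B" for x
      using run[of "x mod s" "x div s"] s by (simp add: beads_def as_def)
    then have "beads s as = B" by blast
    moreover have "as \<in> abacus s"
      using beads_core_iff[of as s] s B calculation by (simp add: as_def)
    ultimately show "B \<in> beads s ` abacus s" by blast
  next
    fix B assume "B \<in> beads s ` abacus s"
    then show "B \<in> core_beads s (s + 2)" using beads_core_iff[OF _ s] by (auto simp: abacus_def)
  qed
qed

section \<open>The size as a sum over pairs of runners\<close>

definition total :: "nat list \<Rightarrow> real" where "total w = real (sum_list w)"
definition choose2_sum :: "nat list \<Rightarrow> real" where "choose2_sum w = (\<Sum>a\<leftarrow>w. real a * (real a - 1) / 2)"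
text \<open>The binomial coefficient of \<open>b - a + 1\<close> over 2 as a polynomial, so that negative differences contribute as
well.\<close>

definition pair_weight :: "nat \<Rightarrow> nat \<Rightarrow> real" where "pair_weight a b = (real b - real a) * (real b - real a + 1) / 2"

fun word_size :: "nat list \<Rightarrow> real" where
  "word_size [] = 0"
| "word_size (a # w) = word_size w + (\<Sum>b\<leftarrow>w. pair_weight a b)"

lemma total_simps [simp]: "total [] = 0" "total (a # w) = real a + total w" by (simp_all add: total_def)
lemma choose2_sum_simps [simp]: "choose2_sum [] = 0" "choose2_sum (a # w) = real a * (real a - 1) / 2 + choose2_sum w" by (simp_all add: choose2_sum_def)

lemma sum_pair_weight: "(\<Sum>b\<leftarrow>w. pair_weight a b) =
    choose2_sum w + total w - real a * total w + real a * (real a - 1) / 2 * real (length w)"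
  by (induction w) (simp_all add: pair_weight_def field_simps)

text \<open>The effect of a new first letter depends on the rest of the word only through its length, its total and its
sum of binomial coefficients.  The recursion below therefore tracks exactly these statistics.\<close>

lemma word_size_Cons: "word_size (a # w) =
    word_size w + choose2_sum w + total w - real a * total w + real a * (real a - 1) / 2 * real (length w)"
  by (simp add: sum_pair_weight)

text \<open>Expanding the squares separates the pair sum into a sum weighted by position, a sum over single
letters and the square of the total.  The same three terms arise when the positions of the beads on an abacus are
summed, which is what makes the size of a core a pair sum.\<close>

lemma word_size_eq: "word_size w =
    (\<Sum>r<length w. real r * real (w ! r)) + real (length w) * choose2_sum w - total w * (total w - 1) / 2"
proof (induction w)
  case (Cons a w)
  have "(\<Sum>r<length (a # w). real r * real ((a # w) ! r)) = (\<Sum>r<length w. (real r + 1) * real (w ! r))"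
    unfolding length_Cons sum.lessThan_Suc_shift by (simp add: add.commute)
  also have "\<dots> = (\<Sum>r<length w. real r * real (w ! r)) + total w"
    by (simp add: algebra_simps sum.distrib total_def sum_list_sum_nth atLeast0LessThan)
  finally have shift: "(\<Sum>r<length (a # w). real r * real ((a # w) ! r)) =
      (\<Sum>r<length w. real r * real (w ! r)) + total w" .
  show ?case unfolding word_size_Cons shift Cons.IH by (simp add: field_simps)
qed simp

lemma sum_runner: "(\<Sum>q<a. real (r + s * q)) = real r * real a + real s * (real a * (real a - 1) / 2)"
  by (induction a) (simp_all add: field_simps)

text \<open>The number of beads is the number of parts, so the correction term in the sum of the beta set is a
function of the total of the bead counts.\<close>

lemma size_eq_word_size:
  assumes p: "is_partition xs" and len: "length as = s" and s: "0 < s" and e: "beta xs = beads s as"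
  shows "real (sum_list xs) = word_size as"
proof -
  have "real (length xs) = (\<Sum>r<s. \<Sum>q<as ! r. 1)"
    using sum_beads[OF s, of "\<lambda>_. 1::real" as] card_beta[OF p] e by simp
  then have m: "real (length xs) = total as"
    using len by (simp add: total_def sum_list_sum_nth atLeast0LessThan)
  have "real (\<Sum>(beta xs)) = (\<Sum>x\<in>beads s as. real x)" by (simp add: e)
  also have "\<dots> = (\<Sum>r<s. real r * real (as ! r) + real s * (real (as ! r) * (real (as ! r) - 1) / 2))"
    by (simp only: sum_beads[OF s] sum_runner)
  also have "\<dots> = (\<Sum>r<s. real r * real (as ! r)) + real s * choose2_sum as"
    using len by (simp add: sum.distrib sum_distrib_left choose2_sum_def sum_list_sum_nth atLeast0LessThan)
  finally show ?thesis using sum_beta[OF p] word_size_eq[of as] m len by simp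
qed

lemma sum_distinct_cores:
  fixes f :: "real \<Rightarrow> real"
  assumes s: "3 \<le> s"
  shows "(\<Sum>xs\<in>distinct_cores s (s + 2). f (real (sum_list xs))) = (\<Sum>as\<in>abacus s. f (word_size as))"
proof -
  let ?D = "distinct_cores s (s + 2)"
  define h where "h = inv_into ?D beta \<circ> beads s"
  have bij: "bij_betw beta ?D (core_beads s (s + 2))" using s by (intro bij_betw_beta) auto
  have "bij_betw h (abacus s) ?D"
    unfolding h_def by (rule bij_betw_trans[OF bij_betw_beads[OF s] bij_betw_inv_into[OF bij]])
  then have "(\<Sum>xs\<in>?D. f (real (sum_list xs))) = (\<Sum>as\<in>abacus s. f (real (sum_list (h as))))"
    by (simp add: sum.reindex_bij_betw[symmetric])
  also have "\<dots> = (\<Sum>as\<in>abacus s. f (word_size as))"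
  proof (rule sum.cong[OF refl])
    fix as assume as: "as \<in> abacus s"
    then have B: "beads s as \<in> core_beads s (s + 2)" using bij_betwE[OF bij_betw_beads[OF s]] by blast
    then have "beta (h as) = beads s as" by (simp only: h_def o_apply bij_betw_inv_into_right[OF bij B])
    moreover have "h as \<in> ?D" using \<open>bij_betw h (abacus s) ?D\<close> as bij_betwE by blast
    then have "is_partition (h as)" by (simp add: distinct_cores_def is_core_def)
    ultimately have "real (sum_list (h as)) = word_size as"
      using as s by (intro size_eq_word_size[where s = s]) (auto simp: abacus_def)
    then show "f (real (sum_list (h as))) = f (word_size as)" by simp
  qed
  finally show ?thesis .
qed

section \<open>Unrolling the abacus into words\<close>

text \<open>The words that remain to be read consist of blocks with one positive letter above the current floor.  The
parameter \<open>g\<close> bounds the next such letter; it is one more than the preceding letter.  In the second phase the floor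
is 0, all blocks are pairs \<open>(0, v)\<close>, and \<open>k\<close> counts them.\<close>

fun phase2 :: "nat \<Rightarrow> nat \<Rightarrow> nat list set" where
  "phase2 0 g = {[]}"
| "phase2 (Suc k) g = (\<Union>v\<in>{1..g}. (\<lambda>w. 0 # v # w) ` phase2 k (Suc v))"

text \<open>In the first phase the floor is 1.  A block is a single letter 1 or a pair \<open>(1, v)\<close> with \<open>v\<close> above the
floor, and at any time the word may drop to the second phase for good.  Here the first argument is the length, since
single letters make both parities possible.\<close>

fun phase1 :: "nat \<Rightarrow> nat \<Rightarrow> nat list set" where
  "phase1 0 g = {[]}"
| "phase1 (Suc 0) g = {[1]}"
| "phase1 (Suc (Suc n)) g =
     (\<lambda>w. 1 # w) ` phase1 (Suc n) 2
     \<union> (\<Union>v\<in>{2..g}. (\<lambda>w. 1 # v # w) ` phase1 n (Suc v))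
     \<union> (if even n then \<Union>v\<in>{1..g}. (\<lambda>w. 0 # v # w) ` phase2 (n div 2) (Suc v) else {})"

text \<open>The linear conditions on an abacus list, with \<open>h\<close> in the role of the entry immediately before the
list: only the second entry of the list is compared with it.\<close>

fun gapped :: "nat \<Rightarrow> nat list \<Rightarrow> bool" where
  "gapped h [] \<longleftrightarrow> True"
| "gapped h [c] \<longleftrightarrow> c = 0"
| "gapped h (c # b # r) \<longleftrightarrow> c = 0 \<and> (if b = 0 then gapped 0 (b # r) else b \<le> h + 1 \<and> gapped b r)"

text \<open>The initial pairs of an abacus list up to its first two consecutive zeros
or its final zero; they become the second phase of
the word.\<close>

fun dominoes :: "nat \<Rightarrow> nat list \<Rightarrow> bool" where
  "dominoes g [] \<longleftrightarrow> True"
| "dominoes g [c] \<longleftrightarrow> False"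
| "dominoes g (c # b # r) \<longleftrightarrow> c = 0 \<and> b \<in> {1..g} \<and> dominoes (Suc b) r"

lemma all_nat_Suc_iff: "(\<forall>r::nat. P r) \<longleftrightarrow> P 0 \<and> (\<forall>r. P (Suc r))"
  by (metis not0_implies_Suc)

lemma gapped_iff: "gapped h xs \<longleftrightarrow> (xs \<noteq> [] \<longrightarrow> xs ! 0 = 0)
    \<and> (\<forall>r. Suc r < length xs \<longrightarrow> xs ! r = 0 \<or> xs ! Suc r = 0)
    \<and> (\<forall>r. r + 2 < length xs \<longrightarrow> xs ! (r + 2) \<le> xs ! r + 1)
    \<and> (1 < length xs \<longrightarrow> xs ! 1 \<le> h + 1)"
proof (induction h xs rule: gapped.induct)
  case (3 h c b r)
  have adj: "(\<forall>i. Suc i < length (u # v) \<longrightarrow> (u # v) ! i = 0 \<or> (u # v) ! Suc i = 0) \<longleftrightarrow>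
      (v \<noteq> [] \<longrightarrow> u = 0 \<or> v ! 0 = 0) \<and> (\<forall>i. Suc i < length v \<longrightarrow> v ! i = 0 \<or> v ! Suc i = 0)"
    for u :: nat and v :: "nat list"
    by (subst all_nat_Suc_iff) simp
  have two: "(\<forall>i. i + 2 < length (u # v) \<longrightarrow> (u # v) ! (i + 2) \<le> (u # v) ! i + 1) \<longleftrightarrow>
      (1 < length v \<longrightarrow> v ! 1 \<le> u + 1) \<and> (\<forall>i. i + 2 < length v \<longrightarrow> v ! (i + 2) \<le> v ! i + 1)"
    for u :: nat and v :: "nat list"
    by (subst all_nat_Suc_iff) simp
  show ?case
  proof (cases "b = 0")
    case True
    then have "gapped h (c # b # r) \<longleftrightarrow> c = 0 \<and> gapped 0 (b # r)" by simp
    then show ?thesis unfolding "3.IH"(1)[OF True] adj[of c] two[of c] using True by auto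
  next
    case False
    then have "gapped h (c # b # r) \<longleftrightarrow> c = 0 \<and> b \<le> h + 1 \<and> gapped b r" by simp
    then show ?thesis unfolding "3.IH"(2)[OF False] adj[of c] two[of c] adj[of b] two[of b]
      using False by auto
  qed
qed auto

lemma gapped_hd: "gapped h (b # r) \<Longrightarrow> b = 0"
  by (cases r) auto

lemma gapped_Cons_0: "gapped 0 x \<Longrightarrow> gapped h (0 # x)"
  by (cases x) (auto dest: gapped_hd)

lemma dominoes_phase2: "dominoes g w \<Longrightarrow> even (length w) \<and> w \<in> phase2 (length w div 2) g"
  by (induction g w rule: dominoes.induct) auto

lemma phase2_dominoes: "w \<in> phase2 k g \<Longrightarrow> dominoes g w \<and> length w = 2 * k"
  by (induction k arbitrary: g w) fastforce+

lemma dominoes_phase1: "dominoes g w \<Longrightarrow> w \<in> phase1 (length w) g"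
  using dominoes_phase2 by (cases "(g, w)" rule: dominoes.cases) fastforce+

lemma phase1_single: "w \<in> phase1 N (Suc (Suc 0)) \<Longrightarrow> length w = N \<Longrightarrow> 1 # w \<in> phase1 (Suc N) g"
  by (cases N) (auto simp: numeral_2_eq_2)

lemma phase1_pair: "w \<in> phase1 N (Suc v) \<Longrightarrow> v \<in> {2..g} \<Longrightarrow> 1 # v # w \<in> phase1 (Suc (Suc N)) g"
  by auto

lemma phase1_intro:
  "gapped h x \<Longrightarrow> dominoes (last (h # x) + 2) y \<Longrightarrow> map Suc x @ y \<in> phase1 (length x + length y) (Suc (Suc h))"
proof (induction h x rule: gapped.induct)
  case (1 h)
  then show ?case using dominoes_phase1 by simp
next
  case (2 h c)
  then have "y \<in> phase1 (length y) (Suc (Suc 0))" using dominoes_phase1[of "Suc (Suc 0)" y] by simp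
  then show ?case using 2 phase1_single[of y] by simp
next
  case (3 h c b r)
  show ?case
  proof (cases "b = 0")
    case True
    then have "map Suc (b # r) @ y \<in> phase1 (length (b # r) + length y) (Suc (Suc 0))"
      using 3 by (intro "3.IH"(1)) auto
    from phase1_single[OF this] show ?thesis using 3 by simp
  next
    case False
    then have "map Suc r @ y \<in> phase1 (length r + length y) (Suc (Suc b))"
      using 3 by (intro "3.IH"(2)) (auto split: if_splits)
    from phase1_pair[OF this, of "Suc (Suc h)"] show ?thesis using 3 False by simp
  qed
qed

lemma phase1_elim:
  "w \<in> phase1 N (Suc (Suc h)) \<Longrightarrow>
     \<exists>x y. w = map Suc x @ y \<and> gapped h x \<and> dominoes (last (h # x) + 2) y \<and> length x + length y = N"
proof (induction N arbitrary: h w rule: induct_nat_012)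
  case 0
  then show ?case by simp
next
  case 1
  then show ?case by (intro exI[of _ "[0]"] exI[of _ "[]"]) simp
next
  case (ge2 N)
  let ?S = "(\<lambda>w. 1 # w) ` phase1 (Suc N) 2"
  let ?P = "\<Union>v\<in>{2..Suc (Suc h)}. (\<lambda>w. 1 # v # w) ` phase1 N (Suc v)"
  let ?L = "\<Union>v\<in>{1..Suc (Suc h)}. (\<lambda>w. 0 # v # w) ` phase2 (N div 2) (Suc v)"
  have "w \<in> ?S \<union> ?P \<union> (if even N then ?L else {})" using ge2.prems by (simp only: phase1.simps)
  then consider "w \<in> ?S" | "w \<in> ?P" | "even N" "w \<in> ?L" by (cases "even N") (simp only: if_True if_False Un_iff, blast)+
  then consider (single) w' where "w = 1 # w'" "w' \<in> phase1 (Suc N) (Suc (Suc 0))"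
    | (pair) v w' where "w = 1 # Suc v # w'" "1 \<le> v" "v \<le> h + 1" "w' \<in> phase1 N (Suc (Suc v))"
    | (last) v w' where "w = 0 # v # w'" "even N" "v \<in> {1..Suc (Suc h)}" "w' \<in> phase2 (N div 2) (Suc v)"
  proof cases
    case 1
    then obtain w' where "w = 1 # w'" "w' \<in> phase1 (Suc N) 2" by blast
    then show ?thesis by (intro that(1)) (simp_all only: numeral_2_eq_2)
  next
    case 2
    then obtain u w' where u: "u \<in> {2..Suc (Suc h)}" "w = 1 # u # w'" "w' \<in> phase1 N (Suc u)" by blast
    moreover obtain v where "u = Suc v" using u(1) by (cases u) auto
    ultimately show ?thesis by (intro that(2)[of v w']) simp_all
  next
    case 3
    then obtain v w' where "v \<in> {1..Suc (Suc h)}" "w = 0 # v # w'" "w' \<in> phase2 (N div 2) (Suc v)" by blast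
    then show ?thesis using 3(1) by (intro that(3))
  qed
  then show ?case
  proof cases
    case single
    then obtain x y where "w' = map Suc x @ y" "gapped 0 x" "dominoes (last (0 # x) + 2) y" "length x + length y = Suc N"
      using ge2.IH(2) by blast
    then show ?thesis using single
      by (intro exI[of _ "0 # x"] exI[of _ y]) (simp add: gapped_Cons_0)
  next
    case pair
    then obtain x y where "w' = map Suc x @ y" "gapped v x" "dominoes (last (v # x) + 2) y" "length x + length y = N"
      using ge2.IH(1) by blast
    then show ?thesis using pair
      by (intro exI[of _ "0 # v # x"] exI[of _ y]) simp
  next
    case last
    then show ?thesis using phase2_dominoes[OF last(4)]
      by (intro exI[of _ "[]"] exI[of _ w]) auto
  qed
qed

text \<open>The length is odd, so pairs cannot exhaust the list, and the first entry that does not begin a pair is a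
zero.\<close>

lemma gapped_split:
  "gapped h as \<Longrightarrow> odd (length as) \<Longrightarrow> \<exists>y x. as = y @ 0 # x \<and> dominoes (h + 1) y \<and> gapped 0 x"
proof (induction h as rule: gapped.induct)
  case (2 h c)
  then show ?case by (intro exI[of _ "[]"]) simp
next
  case (3 h c b r)
  show ?case
  proof (cases "b = 0")
    case True
    then show ?thesis using 3 by (intro exI[of _ "[]"] exI[of _ "b # r"]) simp
  next
    case False
    then obtain y x where "r = y @ 0 # x" "dominoes (b + 1) y" "gapped 0 x"
      using "3.IH"(2)[OF False] "3.prems" by auto
    then show ?thesis using 3 False by (intro exI[of _ "0 # b # y"] exI[of _ x]) simp
  qed
qed simp

lemma gapped_join: "dominoes (h + 1) y \<Longrightarrow> gapped 0 x \<Longrightarrow> gapped h (y @ 0 # x)"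
  by (induction "h + 1" y arbitrary: h rule: dominoes.induct) (auto simp: gapped_Cons_0)

text \<open>Pairs end where a zero is not followed by a positive entry.\<close>

lemma dominoes_join_unique:
  "y @ 0 # x = y' @ 0 # x' \<Longrightarrow> dominoes g y \<Longrightarrow> dominoes g' y' \<Longrightarrow> gapped 0 x \<Longrightarrow> gapped 0 x' \<Longrightarrow> y = y'"
proof (induction g y arbitrary: y' g' rule: dominoes.induct)
  case (1 g)
  then show ?case by (cases "(g', y')" rule: dominoes.cases) (auto dest: gapped_hd)
next
  case (3 g c b r)
  then show ?case by (cases "(g', y')" rule: dominoes.cases) (auto dest: gapped_hd)
qed simp

lemma map_Suc_dominoes_unique:
  "map Suc x @ y = map Suc x' @ y' \<Longrightarrow> dominoes g y \<Longrightarrow> dominoes g' y' \<Longrightarrow> x = x'"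
proof (induction x arbitrary: x')
  case Nil
  then show ?case by (cases x'; cases "(g, y)" rule: dominoes.cases) auto
next
  case (Cons a x)
  then show ?case by (cases x'; cases "(g', y')" rule: dominoes.cases) auto
qed

lemma word_size_snoc: "word_size (y @ [a]) = word_size y + (\<Sum>b\<leftarrow>y. pair_weight b a)"
  by (induction y) simp_all

lemma word_size_rotate1: "word_size (Suc a # y) = word_size (y @ [a])"
proof -
  have "pair_weight (Suc a) = (\<lambda>b. pair_weight b a)" by (rule ext) (simp add: pair_weight_def field_simps)
  then show ?thesis by (simp add: word_size_snoc)
qed

text \<open>Pairs that involve the moved letter keep their weight: \<open>b - (a + 1)\<close> and \<open>a - b\<close> add up to \<open>-1\<close>, and
\<open>z (z + 1)\<close> is symmetric about \<open>-1/2\<close>.\<close>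

lemma word_size_rotate: "word_size (map Suc x @ y) = word_size (y @ x)"
proof (induction x arbitrary: y)
  case (Cons a x)
  then show ?case using word_size_rotate1[of a "map Suc x @ y"] by simp
qed simp

text \<open>The list \<open>y @ 0 # x\<close>, where \<open>y\<close> consists of pairs and \<open>0 # x\<close> begins with two zeros or is a single zero,
corresponds to the word that reads \<open>0 # x\<close> first, raised by one, and then \<open>y\<close>.  The wrap-around condition bounds the
first pair of \<open>y\<close> by the last letter of \<open>0 # x\<close>, which is now the condition between two adjacent blocks.\<close>

lemma sum_abacus:
  fixes f :: "real \<Rightarrow> real"
  assumes n: "1 \<le> n"
  shows "(\<Sum>as\<in>abacus (2 * n + 1). f (word_size as)) = (\<Sum>w\<in>phase1 (2 * n + 1) 1. f (word_size w))"
proof -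
  define P where "P = {(y, x). dominoes (last (0 # x) + 2) y \<and> gapped 0 x \<and> length y + length x = 2 * n}"
  have abacus: "as \<in> abacus (2 * n + 1) \<longleftrightarrow> length as = 2 * n + 1 \<and> gapped (last as + 1) as" for as
  proof (cases "length as = 2 * n + 1")
    case True
    then have "as \<noteq> []" by auto
    then show ?thesis using True n by (auto simp: abacus_def gapped_iff last_conv_nth)
  qed (simp add: abacus_def)
  have "bij_betw (\<lambda>(y, x). y @ 0 # x) P (abacus (2 * n + 1))"
  proof (rule bij_betw_imageI)
    show "inj_on (\<lambda>(y, x). y @ 0 # x) P"
      by (rule inj_onI) (auto simp: P_def dest: dominoes_join_unique)
    show "(\<lambda>(y, x). y @ 0 # x) ` P = abacus (2 * n + 1)"
    proof (intro equalityI subsetI)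
      fix as assume "as \<in> abacus (2 * n + 1)"
      then have as: "length as = 2 * n + 1" "gapped (last as + 1) as" unfolding abacus by blast+
      then obtain y x where "as = y @ 0 # x" "dominoes (last as + 1 + 1) y" "gapped 0 x"
        using gapped_split[OF as(2)] by auto
      then have "as = (\<lambda>(y, x). y @ 0 # x) (y, x)" "(y, x) \<in> P" using as by (simp_all add: P_def)
      then show "as \<in> (\<lambda>(y, x). y @ 0 # x) ` P" by (rule image_eqI)
    next
      fix as assume "as \<in> (\<lambda>(y, x). y @ 0 # x) ` P"
      then obtain y x where "as = y @ 0 # x" "dominoes ((last (0 # x) + 1) + 1) y" "gapped 0 x"
        "length y + length x = 2 * n" by (auto simp: P_def)
      moreover from this have "gapped (last as + 1) as" using gapped_join[of "last (0 # x) + 1" y x] by simp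
      ultimately show "as \<in> abacus (2 * n + 1)" unfolding abacus by simp
    qed
  qed
  then have "(\<Sum>as\<in>abacus (2 * n + 1). f (word_size as)) = (\<Sum>p\<in>P. f (word_size ((\<lambda>(y, x). y @ 0 # x) p)))"
    by (rule sum.reindex_bij_betw[symmetric])
  also have "\<dots> = (\<Sum>p\<in>P. f (word_size ((\<lambda>(y, x). 1 # map Suc x @ y) p)))"
  proof (rule sum.cong[OF refl])
    fix p assume "p \<in> P"
    obtain y x where p: "p = (y, x)" by (cases p)
    then show "f (word_size ((\<lambda>(y, x). y @ 0 # x) p)) = f (word_size ((\<lambda>(y, x). 1 # map Suc x @ y) p))"
      using word_size_rotate[of "0 # x" y] by simp
  qed
  also have "\<dots> = (\<Sum>w\<in>phase1 (2 * n + 1) 1. f (word_size w))"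
  proof (rule sum.reindex_bij_betw, rule bij_betw_imageI)
    (* for bound 1 only the single letter 1 can come first: no pair above the floor fits, and the length is odd *)
    obtain m where "n = Suc m" using n by (cases n) auto
    then have m: "2 * n + 1 = Suc (Suc (Suc (2 * m)))" "2 * n = Suc (Suc (2 * m))" by simp_all
    have "phase1 (Suc (Suc (Suc (2 * m)))) 1 = (\<lambda>w. 1 # w) ` phase1 (Suc (Suc (2 * m))) 2"
      by (subst phase1.simps(3)) (simp del: phase1.simps)
    then have first: "phase1 (2 * n + 1) 1 = (\<lambda>w. 1 # w) ` phase1 (2 * n) (Suc (Suc 0))"
      unfolding m(1) unfolding m(2) by (simp only: numeral_2_eq_2)
    show "inj_on (\<lambda>(y, x). 1 # map Suc x @ y) P"
    proof (rule inj_onI)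
      fix p p' assume "p \<in> P" "p' \<in> P"
        and e: "(\<lambda>(y, x). 1 # map Suc x @ y) p = (\<lambda>(y, x). 1 # map Suc x @ y) p'"
      moreover obtain y x y' x' where "p = (y, x)" "p' = (y', x')" by (cases p; cases p') auto
      ultimately show "p = p'" using map_Suc_dominoes_unique[of x y x' y'] by (auto simp: P_def)
    qed
    show "(\<lambda>(y, x). 1 # map Suc x @ y) ` P = phase1 (2 * n + 1) 1"
    proof (intro equalityI subsetI)
      fix w assume "w \<in> phase1 (2 * n + 1) 1"
      then obtain w' where w: "w = 1 # w'" "w' \<in> phase1 (2 * n) (Suc (Suc 0))" unfolding first by blast
      then obtain x y where "w' = map Suc x @ y" "gapped 0 x" "dominoes (last (0 # x) + 2) y"
        "length x + length y = 2 * n" using phase1_elim by blast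
      then have "w = (\<lambda>(y, x). 1 # map Suc x @ y) (y, x)" "(y, x) \<in> P" using w by (simp_all add: P_def)
      then show "w \<in> (\<lambda>(y, x). 1 # map Suc x @ y) ` P" by (rule image_eqI)
    next
      fix w assume "w \<in> (\<lambda>(y, x). 1 # map Suc x @ y) ` P"
      then obtain y x where yx: "w = 1 # map Suc x @ y" "gapped 0 x" "dominoes (last (0 # x) + 2) y"
        "length y + length x = 2 * n" by (auto simp: P_def)
      then have "map Suc x @ y \<in> phase1 (2 * n) (Suc (Suc 0))"
        using phase1_intro[OF yx(2,3)] by (simp add: add.commute)
      then show "w \<in> phase1 (2 * n + 1) 1" unfolding first yx(1) by (rule imageI)
    qed
  qed
  finally show ?thesis .
qed

section \<open>The Catalan series\<close>

function catalan :: "nat \<Rightarrow> nat" where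
  "catalan 0 = 1"
| "catalan (Suc n) = (\<Sum>i\<le>n. catalan i * catalan (n - i))"
  by pat_completeness auto
termination by (relation "measure id") (auto simp: le_imp_less_Suc)

text \<open>The Catalan series \<open>C\<close>.  It enters through \<open>u = C - 1 = x C\<^sup>2\<close> and \<open>y = u / (1 - u)\<close>; the latter is the
quantity in which \<open>C\<close> and all solutions below have simple derivatives.\<close>

definition Cat :: "real fps" where "Cat = Abs_fps (\<lambda>n. real (catalan n))"

lemma Cat_eq: "Cat = 1 + fps_X * Cat ^ 2"
proof (rule fps_ext)
  fix n
  show "fps_nth Cat n = fps_nth (1 + fps_X * Cat ^ 2) n"
  proof (cases n)
    case (Suc m)
    have "fps_nth Cat (Suc m) = fps_nth (Cat * Cat) m"
      by (simp add: Cat_def fps_mult_nth atLeast0AtMost)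
    then show ?thesis using Suc by (simp add: power2_eq_square)
  qed (simp add: Cat_def)
qed

definition uu :: "real fps" where "uu = Cat - 1"
definition yy :: "real fps" where "yy = uu / (1 - uu)"

lemma uu_nth_0: "fps_nth uu 0 = 0" by (simp add: uu_def Cat_def)
lemma yy_uu: "yy * (1 - uu) = uu"
proof -
  have "fps_nth (1 - uu) 0 \<noteq> 0" by (simp add: uu_nth_0)
  then have "(1 - uu) * inverse (1 - uu) = 1" by (metis inverse_mult_eq_1 mult.commute)
  then show ?thesis by (simp add: yy_def fps_divide_unit uu_nth_0 mult.assoc mult.commute)
qed

lemma one_minus_uu_nz: "1 - uu \<noteq> 0"
proof
  assume "1 - uu = 0"
  then have "fps_nth (1 - uu) 0 = 0" by simp
  then show False by (simp add: uu_nth_0)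
qed

lemma yy_one_plus: "(1 + yy) * (1 - uu) = 1" using yy_uu by (simp add: algebra_simps)

lemma X_Cat: "fps_X * Cat ^ 2 = uu" using Cat_eq by (simp add: uu_def algebra_simps)

text \<open>The Euler derivation \<open>x d/dx\<close>, which multiplies the coefficient of \<open>x\<^sup>n\<close> by \<open>n\<close>.  It is needed because the
length of a word, and with it \<open>n\<close>, enters the size.\<close>

definition theta :: "real fps \<Rightarrow> real fps" where "theta F = fps_X * fps_deriv F"

lemma theta_add: "theta (F + G) = theta F + theta G" by (simp add: theta_def algebra_simps)
lemma theta_mult: "theta (F * G) = theta F * G + F * theta G" by (simp add: theta_def algebra_simps)
lemma theta_of_int: "theta (of_int k) = 0" by (simp add: theta_def)
lemma theta_of_nat: "theta (of_nat k) = 0" by (simp add: theta_def)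
lemma theta_1: "theta 1 = 0" by (simp add: theta_def)
lemma theta_nth: "fps_nth (theta F) n = of_nat n * fps_nth F n"
  by (cases n) (simp_all add: theta_def)

lemma theta_Cat: "theta Cat = yy * Cat"
proof -
  have X: "theta fps_X = fps_X" by (simp add: theta_def)
  have "theta Cat = theta (1 + fps_X * Cat ^ 2)" using Cat_eq by simp
  also have "\<dots> = fps_X * Cat ^ 2 + fps_X * (2 * Cat * theta Cat)"
    by (simp add: theta_add theta_mult theta_1 X power2_eq_square algebra_simps)
  finally have e: "theta Cat = uu + 2 * (fps_X * Cat) * theta Cat" by (simp add: X_Cat algebra_simps)
  have "Cat * (1 - 2 * (fps_X * Cat)) = Cat - 2 * (fps_X * Cat ^ 2)"
    by (simp add: power2_eq_square algebra_simps)
  also have "\<dots> = 1 - uu" by (simp add: X_Cat) (simp add: uu_def)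
  finally have c: "Cat * (1 - 2 * (fps_X * Cat)) = 1 - uu" .
  have "theta Cat * (1 - 2 * (fps_X * Cat)) = uu" using e by (simp add: algebra_simps)
  then have "theta Cat * (Cat * (1 - 2 * (fps_X * Cat))) = uu * Cat" by (metis mult.assoc mult.commute)
  then have "theta Cat * (1 - uu) = (yy * (1 - uu)) * Cat" by (simp only: c yy_uu)
  then have "theta Cat * (1 - uu) = yy * Cat * (1 - uu)" by (simp only: ac_simps)
  then show ?thesis using one_minus_uu_nz by simp
qed

text \<open>The polynomials in \<open>y\<close> are closed under the Euler derivation.\<close>

lemma theta_yy: "theta yy = yy * ((1 + yy) * (1 + 2 * yy))"
proof -
  have tu: "theta uu = yy * (1 + uu)" using theta_Cat by (simp add: uu_def theta_def)
  have "theta (yy * (1 - uu)) = theta uu" by (simp add: yy_uu)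
  moreover have "theta (1 - uu) = - theta uu" by (simp add: theta_def)
  ultimately have "theta yy * (1 - uu) = theta uu * (1 + yy)"
    unfolding theta_mult by (simp add: algebra_simps)
  also have "\<dots> = yy * (1 + uu) * (1 + yy)" by (simp add: tu)
  finally have a: "theta yy * (1 - uu) = yy * (1 + yy) * (1 + uu)" by (simp add: algebra_simps)
  have "(1 + 2 * yy) * (1 - uu) = (1 - uu) + 2 * (yy * (1 - uu))" by (simp add: algebra_simps)
  then have "1 + uu = (1 + 2 * yy) * (1 - uu)" by (simp add: yy_uu)
  then have "theta yy * (1 - uu) = yy * ((1 + yy) * (1 + 2 * yy)) * (1 - uu)" using a by (simp add: mult.assoc)
  then show ?thesis using one_minus_uu_nz by simp
qed

lemma theta_Cat_power: "theta (Cat ^ n) = of_nat n * yy * Cat ^ n"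
  by (induction n) (simp_all add: theta_mult theta_Cat theta_1 algebra_simps)

section \<open>Polynomials in y and in the binomial coefficients of g\<close>

text \<open>Polynomials in \<open>y\<close> are integer coefficient lists, lowest degree first.  Polynomials in \<open>y\<close> and \<open>g\<close> are lists of
these: entry \<open>e\<close> is the coefficient of the binomial coefficient of \<open>g\<close> over \<open>e\<close>.  In this basis difference
operators shift the list, and all coefficients stay integers.\<close>

type_synonym ypoly = "int list"
type_synonym bpoly = "ypoly list"

fun yadd :: "ypoly \<Rightarrow> ypoly \<Rightarrow> ypoly" where
  "yadd [] b = b"
| "yadd (x # a) [] = x # a"
| "yadd (x # a) (y # b) = (x + y) # yadd a b"

fun yscale :: "int \<Rightarrow> ypoly \<Rightarrow> ypoly" where
  "yscale k [] = []"
| "yscale k (x # a) = (k * x) # yscale k a"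

text \<open>The product rule for \<open>y (1 + y) (1 + 2y)\<close> times a derivative, in one pass: \<open>i\<close> is the current degree and
\<open>q\<close>, \<open>r\<close> are the two previous coefficients multiplied by their degrees.\<close>

fun ytheta_aux :: "int \<Rightarrow> int \<Rightarrow> int \<Rightarrow> ypoly \<Rightarrow> ypoly" where
  "ytheta_aux i q r [] = [3 * q + 2 * r, 2 * q]"
| "ytheta_aux i q r (x # a) = (i * x + (3 * q + 2 * r)) # ytheta_aux (i + 1) (i * x) q a"

fun badd :: "bpoly \<Rightarrow> bpoly \<Rightarrow> bpoly" where
  "badd [] q = q"
| "badd (a # p) [] = a # p"
| "badd (a # p) (b # q) = yadd a b # badd p q"

fun bscale :: "int \<Rightarrow> bpoly \<Rightarrow> bpoly" where
  "bscale k [] = []"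
| "bscale k (a # p) = yscale k a # bscale k p"

text \<open>Substitution of \<open>g + 1\<close> for \<open>g\<close>, by Pascal's rule.\<close>

fun bshift :: "bpoly \<Rightarrow> bpoly" where
  "bshift [] = []"
| "bshift [a] = [a]"
| "bshift (a # b # p) = yadd a b # bshift (b # p)"

text \<open>Multiplication by the linear polynomial \<open>s g + c\<close> (shown in \<open>beval_blinear\<close>); \<open>e\<close> is the current index and
\<open>b\<close> the previous coefficient.\<close>

fun blinear_aux :: "int \<Rightarrow> int \<Rightarrow> int \<Rightarrow> ypoly \<Rightarrow> bpoly \<Rightarrow> bpoly" where
  "blinear_aux s c e b [] = [yscale (s * e) b]"
| "blinear_aux s c e b (a # p) = yadd (yscale (s * e + c) a) (yscale (s * e) b) # blinear_aux s c (e + 1) a p"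

definition blinear :: "int \<Rightarrow> int \<Rightarrow> bpoly \<Rightarrow> bpoly" where
  "blinear s c p = blinear_aux s c 0 [] p"

text \<open>Multiplication by \<open>(g - 1) (g - 2) / 2\<close> (shown in \<open>beval_bchoose2\<close>).  Here \<open>e\<close> is the current index, \<open>k\<close> is
the binomial coefficient of \<open>e\<close> over 2, and \<open>b\<close> and \<open>d\<close> are the two previous coefficients.\<close>

fun bchoose2_aux :: "int \<Rightarrow> int \<Rightarrow> ypoly \<Rightarrow> ypoly \<Rightarrow> bpoly \<Rightarrow> bpoly" where
  "bchoose2_aux e k b d [] = [yadd (yscale (2 * k - e) b) (yscale k d), yscale (k + e) b]"
| "bchoose2_aux e k b d (a # p) =
     yadd (yscale (k + 1 - e) a) (yadd (yscale (2 * k - e) b) (yscale k d)) # bchoose2_aux (e + 1) (k + e) a b p"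

definition bchoose2 :: "bpoly \<Rightarrow> bpoly" where
  "bchoose2 p = bchoose2_aux 0 0 [] [] p"

fun btheta_y :: "bpoly \<Rightarrow> bpoly" where
  "btheta_y [] = []"
| "btheta_y (a # p) = ytheta_aux 0 0 0 a # btheta_y p"

fun bmul_y :: "bpoly \<Rightarrow> bpoly" where
  "bmul_y [] = []"
| "bmul_y (a # p) = (0 # a) # bmul_y p"

text \<open>If \<open>p\<close> represents \<open>C\<^bsup>g + r\<^esup> p(g)\<close>, summed over words of length \<open>2k + r\<close>, then this represents the
sum weighted by the length plus one: the length acts as \<open>2\<theta> + r\<close>, and the Euler derivation of \<open>C\<^bsup>g + r\<^esup>\<close> contributes
\<open>(g + r) y\<close>.\<close>

definition blength :: "int \<Rightarrow> bpoly \<Rightarrow> bpoly" where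
  "blength r p = badd (bscale 2 (badd (bmul_y (blinear 1 r p)) (btheta_y p))) (bscale (1 + r) p)"

text \<open>The equation \<open>D(g) = u (D(g + 1) + p(g))\<close> is equivalent to \<open>D = y (p + \<Delta>D)\<close> for the difference operator
\<open>\<Delta>\<close>.  As \<open>\<Delta>\<close> shifts coefficient lists by one, the top coefficient of \<open>D\<close> is \<open>y\<close> times that of \<open>p\<close>, and
the others follow downwards.\<close>

fun bsolve_cons :: "ypoly \<Rightarrow> bpoly \<Rightarrow> bpoly" where
  "bsolve_cons a [] = [0 # a]"
| "bsolve_cons a (d # q) = (0 # yadd a d) # d # q"

fun bsolve :: "bpoly \<Rightarrow> bpoly" where
  "bsolve [] = []"
| "bsolve (a # p) = bsolve_cons a (bsolve p)"

text \<open>A copy of the binomial coefficient with equations that evaluate on successor terms.\<close>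

fun binom :: "nat \<Rightarrow> nat \<Rightarrow> int" where
  "binom n 0 = 1"
| "binom 0 (Suc k) = 0"
| "binom (Suc n) (Suc k) = binom n k + binom n (Suc k)"

text \<open>With a row of Pascal's triangle as first argument this is evaluation at a small value of \<open>g\<close>.\<close>

fun ydot :: "int list \<Rightarrow> bpoly \<Rightarrow> ypoly" where
  "ydot [] p = []"
| "ydot (c # cs) [] = []"
| "ydot (c # cs) (a # p) = yadd (yscale c a) (ydot cs p)"

text \<open>Replaces the constant coefficient, that is, the value at \<open>g = 0\<close>.\<close>

fun base0 :: "ypoly \<Rightarrow> bpoly \<Rightarrow> bpoly" where
  "base0 a [] = [a]"
| "base0 a (b # q) = a # q"

text \<open>A solution \<open>P\<close> of \<open>P(g + 1) - P(g) = d(g + 2)\<close>.\<close>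

definition integ :: "bpoly \<Rightarrow> bpoly" where
  "integ d = bshift (bshift ([] # d))"

fun snd_coeff :: "bpoly \<Rightarrow> ypoly" where
  "snd_coeff [] = []" | "snd_coeff [a] = []" | "snd_coeff (a # b # p) = b"

text \<open>Adjusts the constant coefficient so that the value at \<open>g = 1\<close> becomes \<open>a\<close>.\<close>

definition base1 :: "ypoly \<Rightarrow> bpoly \<Rightarrow> bpoly" where
  "base1 a q = base0 (yadd a (yscale (-1) (snd_coeff q))) q"

fun yeval :: "ypoly \<Rightarrow> real fps" where
  "yeval [] = 0"
| "yeval (x # a) = of_int x + yy * yeval a"

text \<open>The offset \<open>e\<close> is the index of the first entry of the list, as in the recursions that carry the index along.\<close>

fun beval_at :: "nat \<Rightarrow> bpoly \<Rightarrow> nat \<Rightarrow> real fps" where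
  "beval_at e [] g = 0"
| "beval_at e (a # p) g = of_nat (g choose e) * yeval a + beval_at (Suc e) p g"

abbreviation beval :: "bpoly \<Rightarrow> nat \<Rightarrow> real fps" where "beval \<equiv> beval_at 0"

lemma yeval_yadd [simp]: "yeval (yadd a b) = yeval a + yeval b"
  by (induction a b rule: yadd.induct) (auto simp: algebra_simps)

lemma yeval_yscale [simp]: "yeval (yscale k a) = of_int k * yeval a"
  by (induction k a rule: yscale.induct) (auto simp: algebra_simps)

lemma beval_at_badd: "beval_at e (badd p q) g = beval_at e p g + beval_at e q g"
  by (induction p q arbitrary: e rule: badd.induct) (auto simp: algebra_simps)

lemma beval_at_bscale: "beval_at e (bscale k p) g = of_int k * beval_at e p g"
  by (induction k p arbitrary: e rule: bscale.induct) (auto simp: algebra_simps)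

lemma beval_at_bmul_y: "beval_at e (bmul_y p) g = yy * beval_at e p g"
  by (induction p arbitrary: e rule: bmul_y.induct) (auto simp: algebra_simps)

lemma yeval_ytheta_aux:
  "yeval (ytheta_aux i q r a) =
     of_int i * yeval a * ((1 + yy) * (1 + 2 * yy)) + theta (yeval a) + of_int (3 * q + 2 * r) + of_int (2 * q) * yy"
  by (induction i q r a rule: ytheta_aux.induct)
    (simp_all add: theta_add theta_mult theta_of_int theta_yy theta_def[of 0] algebra_simps power2_eq_square)

lemma beval_at_btheta_y: "beval_at e (btheta_y p) g = theta (beval_at e p g)"
  by (induction p arbitrary: e rule: btheta_y.induct)
    (auto simp: yeval_ytheta_aux theta_add theta_mult theta_of_nat theta_def[of 0])

text \<open>Multiplication by \<open>g\<close> in the basis of binomial coefficients.\<close>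

lemma choose_times: "of_nat g * of_nat (g choose e) =
    (of_nat e * of_nat (g choose e) + of_nat (Suc e) * of_nat (g choose Suc e) :: 'a :: comm_ring_1)"
proof -
  have "Suc e * (g choose Suc e) + e * (g choose e) = g * (g choose e)"
  proof (cases "e \<le> g")
    case True
    have "Suc e * (g choose Suc e) = (g - e) * (g choose e)"
      using binomial_absorb_comp[of g e] by (metis binomial_absorption mult.commute binomial_absorb_comp)
    then show ?thesis using True by (simp add: add_mult_distrib[symmetric])
  qed (simp add: binomial_eq_0)
  then have "of_nat (Suc e * (g choose Suc e) + e * (g choose e)) = (of_nat (g * (g choose e)) :: 'a)" by (rule arg_cong)
  then show ?thesis by (simp only: of_nat_add of_nat_mult) (simp add: algebra_simps)
qed

lemma beval_at_blinear_aux: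
  "beval_at e (blinear_aux s c (int e) b p) g =
     (of_int s * of_nat g + of_int c) * beval_at e p g + of_int (s * int e) * of_nat (g choose e) * yeval b"
proof (induction p arbitrary: e b)
  case (Cons a p)
  have ct: "of_nat g * of_nat (g choose e) =
    (of_nat e * of_nat (g choose e) + of_nat (Suc e) * of_nat (g choose Suc e) :: real fps)" by (rule choose_times)
  have IH: "beval_at (Suc e) (blinear_aux s c (int e + 1) a p) g =
     (of_int s * of_nat g + of_int c) * beval_at (Suc e) p g + of_int (s * (int e + 1)) * of_nat (g choose Suc e) * yeval a"
    using Cons.IH[of "Suc e" a] by (simp add: add.commute)
  have "(of_int s * of_nat g + of_int c) * (of_nat (g choose e) * yeval a) =
     of_int s * (of_nat g * of_nat (g choose e)) * yeval a + of_int c * of_nat (g choose e) * yeval a"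
    by (simp add: algebra_simps)
  also have "\<dots> = of_int (s * int e + c) * of_nat (g choose e) * yeval a + of_int (s * (int e + 1)) * of_nat (g choose Suc e) * yeval a"
    unfolding ct by (simp add: algebra_simps)
  finally show ?case using IH by (simp add: algebra_simps)
qed (simp add: algebra_simps)

lemma beval_blinear: "beval (blinear s c p) g = (of_int s * of_nat g + of_int c) * beval p g"
  using beval_at_blinear_aux[of 0 s c "[]" p g] by (simp add: blinear_def)

text \<open>Multiplication by \<open>g\<close> takes the basis element of index \<open>e\<close> to a combination of those of index \<open>e\<close> and
\<open>e + 1\<close>; applying this twice gives the three coefficients that \<open>bchoose2_aux\<close> distributes.\<close>

lemma beval_at_bchoose2_aux:
  assumes "2 * k = int e * (int e - 1)"
  shows "2 * beval_at e (bchoose2_aux (int e) k b d p) g =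
     (of_nat g - 1) * (of_nat g - 2) * beval_at e p g
     + 2 * (of_nat (g choose e) * (of_int (2 * k - int e) * yeval b + of_int k * yeval d)
            + of_nat (g choose Suc e) * (of_int (k + int e) * yeval b))"
  using assms
proof (induction p arbitrary: e k b d)
  case (Cons a p)
  have c1: "of_nat g * of_nat (g choose e) =
    (of_nat e * of_nat (g choose e) + of_nat (Suc e) * of_nat (g choose Suc e) :: real fps)" by (rule choose_times)
  have c2: "of_nat g * of_nat (g choose Suc e) =
    (of_nat (Suc e) * of_nat (g choose Suc e) + of_nat (Suc (Suc e)) * of_nat (g choose Suc (Suc e)) :: real fps)"
    by (rule choose_times)
  have k: "2 * of_int k = (of_nat e * (of_nat e - 1) :: real fps)"
    using Cons.prems by (metis of_int_1 of_int_diff of_int_mult of_int_numeral of_int_of_nat_eq)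
  have "2 * (k + int e) = int (Suc e) * (int (Suc e) - 1)" using Cons.prems by (simp add: algebra_simps)
  from Cons.IH[OF this, of a b]
  have IH: "2 * beval_at (Suc e) (bchoose2_aux (int e + 1) (k + int e) a b p) g =
     (of_nat g - 1) * (of_nat g - 2) * beval_at (Suc e) p g
     + 2 * (of_nat (g choose Suc e) * (of_int (2 * (k + int e) - (int e + 1)) * yeval a + of_int (k + int e) * yeval b)
            + of_nat (g choose Suc (Suc e)) * (of_int (k + int e + (int e + 1)) * yeval a))"
    by (simp add: add.commute)
  define G where "G = (of_nat g :: real fps)"
  define E where "E = (of_nat e :: real fps)"
  define A0 where "A0 = (of_nat (g choose e) :: real fps)"
  define A1 where "A1 = (of_nat (g choose Suc e) :: real fps)"
  define A2 where "A2 = (of_nat (g choose Suc (Suc e)) :: real fps)"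
  define K where "K = (of_int k :: real fps)"
  have c1': "G * A0 = E * A0 + (E + 1) * A1" using c1 by (simp add: G_def E_def A0_def A1_def algebra_simps)
  have c2': "G * A1 = (E + 1) * A1 + (E + 2) * A2" using c2 by (simp add: G_def E_def A2_def A1_def algebra_simps)
  have EE: "E * E = 2 * K + E" using k by (simp add: K_def E_def algebra_simps)
  have GG: "G * (G * A0) = E * (G * A0) + (E + 1) * (G * A1)"
  proof -
    have "G * (G * A0) = G * (E * A0 + (E + 1) * A1)" by (simp only: c1')
    then show ?thesis by (simp add: algebra_simps)
  qed
  have "(G - 1) * (G - 2) * A0 = G * (G * A0) - 3 * (G * A0) + 2 * A0" by (simp add: algebra_simps)
  also have "\<dots> = E * (G * A0) + (E + 1) * (G * A1) - 3 * (G * A0) + 2 * A0"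
    by (simp only: GG)
  also have "\<dots> = (E * E - 3 * E + 2) * A0 + (2 * (E * E) - 2) * A1 + (E * E + 3 * E + 2) * A2"
    unfolding c1' c2' by (simp add: algebra_simps)
  also have "\<dots> = (2 * K - 2 * E + 2) * A0 + (4 * K + 2 * E - 2) * A1 + (2 * K + 4 * E + 2) * A2"
    unfolding EE by (simp add: algebra_simps)
  finally have key: "(G - 1) * (G - 2) * A0 =
    (2 * K - 2 * E + 2) * A0 + (4 * K + 2 * E - 2) * A1 + (2 * K + 4 * E + 2) * A2" .
  have "2 * beval_at e (bchoose2_aux (int e) k b d (a # p)) g =
     2 * (A0 * ((K + 1 - E) * yeval a + ((2 * K - E) * yeval b + K * yeval d)))
     + 2 * beval_at (Suc e) (bchoose2_aux (int e + 1) (k + int e) a b p) g"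
    by (simp add: A0_def K_def E_def algebra_simps)
  also have "\<dots> = 2 * (A0 * ((K + 1 - E) * yeval a + ((2 * K - E) * yeval b + K * yeval d)))
     + (G - 1) * (G - 2) * beval_at (Suc e) p g
     + 2 * (A1 * ((2 * (K + E) - (E + 1)) * yeval a + (K + E) * yeval b) + A2 * ((K + E + (E + 1)) * yeval a))"
    unfolding IH by (simp add: A1_def A2_def K_def E_def G_def)
  also have "\<dots> = ((2 * K - 2 * E + 2) * A0 + (4 * K + 2 * E - 2) * A1 + (2 * K + 4 * E + 2) * A2) * yeval a
     + (G - 1) * (G - 2) * beval_at (Suc e) p g + 2 * (A0 * ((2 * K - E) * yeval b + K * yeval d) + A1 * ((K + E) * yeval b))"
    by (simp add: algebra_simps)
  also have "\<dots> = (G - 1) * (G - 2) * beval_at e (a # p) g + 2 * (A0 * ((2 * K - E) * yeval b + K * yeval d) + A1 * ((K + E) * yeval b))"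
    unfolding key[symmetric] by (simp add: A0_def algebra_simps)
  finally show ?case by (simp add: A0_def A1_def K_def E_def G_def)
qed (simp add: algebra_simps)

lemma beval_bchoose2: "2 * beval (bchoose2 p) g = (of_nat g - 1) * (of_nat g - 2) * beval p g"
  using beval_at_bchoose2_aux[of 0 0 "[]" "[]" p g] by (simp add: bchoose2_def)

lemma beval_blength: "beval (blength r p) g = 2 * (theta (beval p g) + (of_nat g + of_int r) * yy * beval p g) + (1 + of_int r) * beval p g"
  by (simp add: blength_def beval_at_badd beval_at_bscale beval_at_bmul_y beval_at_btheta_y beval_blinear algebra_simps)

lemma beval_at_Suc_Suc: "beval_at (Suc e) p (Suc g) = beval_at (Suc e) p g + beval_at e p g"
  by (induction p arbitrary: e) (simp_all add: algebra_simps)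

lemma beval_at_bshift: "beval_at e (bshift (a # p)) g = of_nat (g choose e) * yeval a + beval_at (Suc e) p (Suc g)"
proof (induction p arbitrary: a e)
  case (Cons b p)
  show ?case using Cons.IH[of "Suc e" b] by (simp add: algebra_simps)
qed simp

lemma beval_bshift: "beval (bshift p) g = beval p (Suc g)"
  using beval_at_bshift[of 0 _ _ g] by (cases p) auto

lemma beval_integ: "beval (integ d) (Suc g) = beval (integ d) g + beval d (g + 2)"
  using beval_at_Suc_Suc[of 0 d "g + 2"] by (simp add: integ_def beval_bshift)

lemma beval_tl: "beval d (Suc X) = beval d X + beval (tl d) X"
  by (cases d) (simp_all add: beval_at_Suc_Suc)

lemma beval_at_bsolve: "beval_at e (bsolve p) X = yy * (beval_at e p X + beval_at e (tl (bsolve p)) X)"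
proof (induction p arbitrary: e)
  case (Cons a p)
  show ?case
  proof (cases "bsolve p")
    case Nil
    then show ?thesis using Cons.IH[of "Suc e"] by (simp add: algebra_simps)
  next
    case (Cons d q)
    then show ?thesis using Cons.IH[of "Suc e"] by (simp add: algebra_simps)
  qed
qed simp

lemma beval_bsolve: "beval (bsolve p) X = uu * (beval (bsolve p) (Suc X) + beval p X)"
proof -
  have "beval (bsolve p) X * (1 - uu) = yy * (1 - uu) * (beval p X + beval (tl (bsolve p)) X)"
    by (subst beval_at_bsolve) (simp add: algebra_simps)
  also have "\<dots> = uu * (beval p X + beval (bsolve p) (Suc X) - beval (bsolve p) X)"
    by (simp add: yy_uu beval_tl)
  finally show ?thesis by (simp add: algebra_simps)
qed

lemma beval_at_eq_0: "g < e \<Longrightarrow> beval_at e p g = 0"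
  by (induction p arbitrary: e) (simp_all add: binomial_eq_0)

lemma beval_base0: "beval (base0 a q) g = beval q g - beval q 0 + yeval a"
  by (cases q) (simp_all add: beval_at_eq_0)

lemma ydot_11: "yeval (ydot [1, 1] p) = beval p 1"
proof (cases p)
  case (Cons a q) then show ?thesis by (cases q) (simp_all add: beval_at_eq_0)
qed simp

lemma ydot_121: "yeval (ydot [1, 2, 1] p) = beval p 2"
proof (cases p)
  case (Cons a q) then show ?thesis
  proof (cases q)
    case (Cons b r) then show ?thesis using \<open>p = a # q\<close> by (cases r) (simp_all add: beval_at_eq_0 numeral_2_eq_2)
  qed simp
qed simp

lemma ydot_1331: "yeval (ydot [1, 3, 3, 1] p) = beval p 3"
proof (cases p)
  case c1: (Cons a q) then show ?thesis
  proof (cases q)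
    case c2: (Cons b r) then show ?thesis
    proof (cases r)
      case c3: (Cons c s) then show ?thesis using c1 c2
        by (cases s) (simp_all add: beval_at_eq_0 numeral_3_eq_3 numeral_2_eq_2)
    qed (use c1 in \<open>simp add: numeral_3_eq_3\<close>)
  qed simp
qed simp

lemma beval_base1: "beval (base1 a q) g = beval q g - beval q 1 + yeval a"
proof -
  have "beval q 1 = beval q 0 + yeval (snd_coeff q)"
    by (cases q rule: snd_coeff.cases) (simp_all add: beval_at_eq_0)
  then show ?thesis by (simp add: base1_def beval_base0)
qed

lemma binom_eq: "binom n k = int (n choose k)"
  by (induction n k rule: binom.induct) auto

section \<open>Generating functions of the word families\<close>

lemma finite_phase2 [simp]: "finite (phase2 k g)"
  by (induction k g rule: phase2.induct) auto

lemma finite_phase1 [simp]: "finite (phase1 n g)"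
  by (induction n g rule: phase1.induct) auto

lemma length_phase2: "w \<in> phase2 k g \<Longrightarrow> length w = 2 * k"
  by (induction k g arbitrary: w rule: phase2.induct) auto

lemma length_phase1: "w \<in> phase1 n g \<Longrightarrow> length w = n"
  by (induction n g arbitrary: w rule: phase1.induct) (auto dest: length_phase2 split: if_splits)

lemma sum_phase2_Suc:
  "sum f (phase2 (Suc k) g) = (\<Sum>v=1..g. \<Sum>w\<in>phase2 k (Suc v). f (0 # v # w))"
  for f :: "nat list \<Rightarrow> real"
proof -
  have "sum f (phase2 (Suc k) g) = (\<Sum>v\<in>{1..g}. sum f ((\<lambda>w. 0 # v # w) ` phase2 k (Suc v)))"
    by (simp only: phase2.simps) (rule sum.UNION_disjoint; auto)
  also have "\<dots> = (\<Sum>v=1..g. \<Sum>w\<in>phase2 k (Suc v). f (0 # v # w))"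
    by (rule sum.cong[OF refl], subst sum.reindex) (auto simp: inj_on_def)
  finally show ?thesis .
qed

lemma hd_phase1: "w \<in> phase1 (Suc n) 2 \<Longrightarrow> hd w \<le> 1"
  by (cases n) (auto split: if_splits)

lemma sum_phase1_Suc_Suc:
  "sum f (phase1 (Suc (Suc n)) g) =
     (\<Sum>w\<in>phase1 (Suc n) 2. f (1 # w))
     + (\<Sum>v=2..g. \<Sum>w\<in>phase1 n (Suc v). f (1 # v # w))
     + (if even n then \<Sum>v=1..g. \<Sum>w\<in>phase2 (n div 2) (Suc v). f (0 # v # w) else 0)"
  for f :: "nat list \<Rightarrow> real"
proof -
  let ?A = "(\<lambda>w. 1 # w) ` phase1 (Suc n) 2"
  let ?B = "\<Union>v\<in>{2..g}. (\<lambda>w. 1 # v # w) ` phase1 n (Suc v)"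
  let ?C = "if even n then \<Union>v\<in>{1..g}. (\<lambda>w. 0 # v # w) ` phase2 (n div 2) (Suc v) else {}"
  have AB: "?A \<inter> ?B = {}"
  proof -
    have False if "1 # w = 1 # v # w'" "w \<in> phase1 (Suc n) 2" "v \<in> {2..g}" for w v w'
      using that hd_phase1[of w n] by auto
    then show ?thesis by blast
  qed
  have ABC: "(?A \<union> ?B) \<inter> ?C = {}" by (auto split: if_splits)
  have fin: "finite ?A" "finite ?B" "finite ?C" by auto
  have "sum f (phase1 (Suc (Suc n)) g) = sum f ?A + sum f ?B + sum f ?C"
    unfolding phase1.simps using fin AB ABC
    by (subst sum.union_disjoint; (simp only: finite_Un)?) (auto simp: sum.union_disjoint)
  moreover have "sum f ?A = (\<Sum>w\<in>phase1 (Suc n) 2. f (1 # w))" by (simp add: sum.reindex inj_on_def)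
  moreover have "sum f ?B = (\<Sum>v=2..g. \<Sum>w\<in>phase1 n (Suc v). f (1 # v # w))"
  proof -
    have "sum f ?B = (\<Sum>v\<in>{2..g}. sum f ((\<lambda>w. 1 # v # w) ` phase1 n (Suc v)))"
      by (rule sum.UNION_disjoint; auto)
    also have "\<dots> = (\<Sum>v=2..g. \<Sum>w\<in>phase1 n (Suc v). f (1 # v # w))"
      by (rule sum.cong[OF refl], subst sum.reindex) (auto simp: inj_on_def)
    finally show ?thesis .
  qed
  moreover have "sum f ?C = (if even n then \<Sum>v=1..g. \<Sum>w\<in>phase2 (n div 2) (Suc v). f (0 # v # w) else 0)"
  proof -
    have "sum f (\<Union>v\<in>{1..g}. (\<lambda>w. 0 # v # w) ` phase2 (n div 2) (Suc v))
        = (\<Sum>v\<in>{1..g}. sum f ((\<lambda>w. 0 # v # w) ` phase2 (n div 2) (Suc v)))"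
      by (rule sum.UNION_disjoint; auto)
    also have "\<dots> = (\<Sum>v=1..g. \<Sum>w\<in>phase2 (n div 2) (Suc v). f (0 # v # w))"
      by (rule sum.cong[OF refl], subst sum.reindex) (auto simp: inj_on_def)
    finally show ?thesis by auto
  qed
  ultimately show ?thesis by simp
qed

lemma sum_atLeast1_Suc: "1 \<le> g \<Longrightarrow> (\<Sum>v=(2::nat)..Suc g. h v) = (\<Sum>v=2..g. h v) + h (Suc g)"
  for h :: "nat \<Rightarrow> 'a :: comm_monoid_add"
  by (simp add: sum.cl_ivl_Suc)

definition gf :: "(nat \<Rightarrow> nat list set) \<Rightarrow> (nat list \<Rightarrow> real) \<Rightarrow> real fps" where
  "gf L f = Abs_fps (\<lambda>k. \<Sum>w\<in>L k. f w)"

lemma gf_add: "gf L (\<lambda>w. f w + h w) = gf L f + gf L h"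
  by (rule fps_ext) (simp add: gf_def sum.distrib)

lemma gf_scale: "gf L (\<lambda>w. c * f w) = fps_const c * gf L f"
  by (rule fps_ext) (simp add: gf_def sum_distrib_left)

lemma gf_sum: "gf L (\<lambda>w. \<Sum>t\<in>I. f t w) = (\<Sum>t\<in>I. gf L (f t))"
  by (rule fps_ext) (simp add: gf_def fps_sum_nth sum.swap[of _ I])

text \<open>All words counted by the coefficient of \<open>x\<^sup>k\<close> have the same length, so the length is a multiple of the
Euler derivation up to a constant.\<close>

lemma gf_length:
  assumes "\<And>k w. w \<in> L k \<Longrightarrow> length w = 2 * k + r"
  shows "gf L (\<lambda>w. (real (length w) + 1) * f w) = 2 * theta (gf L f) + (1 + of_nat r) * gf L f"
proof (rule fps_ext)
  fix k
  have "(\<Sum>w\<in>L k. (real (length w) + 1) * f w) = (\<Sum>w\<in>L k. (2 * real k + 1 + real r) * f w)"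
    by (rule sum.cong) (auto dest: assms simp: add_ac)
  also have "\<dots> = (2 * real k + 1 + real r) * (\<Sum>w\<in>L k. f w)" by (simp add: sum_distrib_left)
  finally have e: "(\<Sum>w\<in>L k. (real (length w) + 1) * f w) = (2 * real k + 1 + real r) * (\<Sum>w\<in>L k. f w)" .
  have n: "fps_nth ((1 + of_nat r) * F) k = (1 + real r) * fps_nth F k" for F :: "real fps"
    by (simp add: distrib_right fps_of_nat[symmetric])
  have m: "fps_nth (2 * F) k = 2 * fps_nth F k" for F :: "real fps"
    by (simp add: fps_numeral_fps_const)
  show "fps_nth (gf L (\<lambda>w. (real (length w) + 1) * f w)) k
      = fps_nth (2 * theta (gf L f) + (1 + of_nat r) * gf L f) k"
    by (simp only: fps_add_nth n m theta_nth gf_def fps_nth_Abs_fps e) (simp add: algebra_simps)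
qed

text \<open>The words of the second phase by number of pairs, and the words of the first phase of even and of odd length.\<close>

definition LW :: "nat \<Rightarrow> nat \<Rightarrow> nat list set" where "LW g k = phase2 k g"
definition LE :: "nat \<Rightarrow> nat \<Rightarrow> nat list set" where "LE g k = phase1 (2 * k) g"
definition LO :: "nat \<Rightarrow> nat \<Rightarrow> nat list set" where "LO g k = phase1 (2 * k + 1) g"

lemma gfW_0: "gf (LW 0) f = fps_const (f [])"
proof (rule fps_ext)
  fix k show "fps_nth (gf (LW 0) f) k = fps_nth (fps_const (f [])) k"
    by (cases k) (simp_all add: gf_def LW_def sum_phase2_Suc)
qed

lemma gfW_Suc: "gf (LW (Suc g)) f - gf (LW g) f = fps_X * gf (LW (g + 2)) (\<lambda>w. f (0 # Suc g # w))"
proof (rule fps_ext)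
  fix k show "fps_nth (gf (LW (Suc g)) f - gf (LW g) f) k
      = fps_nth (fps_X * gf (LW (g + 2)) (\<lambda>w. f (0 # Suc g # w))) k"
    by (cases k) (simp_all add: gf_def LW_def sum_phase2_Suc del: phase2.simps(2))
qed

text \<open>Raising the bound from \<open>g\<close> to \<open>g + 1\<close> admits exactly the words whose first block has the positive letter
\<open>g + 1\<close>.  The first block may also be the first one of the second phase.\<close>

lemma gfE_Suc:
  assumes "1 \<le> g"
  shows "gf (LE (Suc g)) f - gf (LE g) f =
    fps_X * (gf (LE (g + 2)) (\<lambda>w. f (1 # Suc g # w)) + gf (LW (g + 2)) (\<lambda>w. f (0 # Suc g # w)))"
proof (rule fps_ext)
  have "g \<noteq> 0" using assms by simp
  fix k show "fps_nth (gf (LE (Suc g)) f - gf (LE g) f) k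
      = fps_nth (fps_X * (gf (LE (g + 2)) (\<lambda>w. f (1 # Suc g # w)) + gf (LW (g + 2)) (\<lambda>w. f (0 # Suc g # w)))) k"
    using \<open>g \<noteq> 0\<close>
    by (cases k) (simp_all add: gf_def LE_def LW_def sum_phase1_Suc_Suc sum_atLeast1_Suc del: phase1.simps(3))
qed

lemma gfO_Suc:
  assumes "1 \<le> g"
  shows "gf (LO (Suc g)) f - gf (LO g) f = fps_X * gf (LO (g + 2)) (\<lambda>w. f (1 # Suc g # w))"
proof (rule fps_ext)
  have "g \<noteq> 0" using assms by simp
  fix k show "fps_nth (gf (LO (Suc g)) f - gf (LO g) f) k
      = fps_nth (fps_X * gf (LO (g + 2)) (\<lambda>w. f (1 # Suc g # w))) k"
    using \<open>g \<noteq> 0\<close>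
    by (cases k) (simp_all add: gf_def LO_def sum_phase1_Suc_Suc sum_atLeast1_Suc del: phase1.simps(3))
qed

text \<open>For \<open>g = 1\<close> no pair above the floor fits, so the word begins with a single letter 1 or is already in its second
phase.  Together with the next equation this couples the two parities.\<close>

lemma gfE_1: "gf (LE 1) f = fps_X * gf (LO 2) (\<lambda>w. f (1 # w)) + gf (LW 1) f"
proof (rule fps_ext)
  fix k show "fps_nth (gf (LE 1) f) k = fps_nth (fps_X * gf (LO 2) (\<lambda>w. f (1 # w)) + gf (LW 1) f) k"
    by (cases k) (simp_all add: gf_def LE_def LO_def LW_def sum_phase1_Suc_Suc sum_phase2_Suc del: phase1.simps(3) phase2.simps(2))
qed

lemma gfO_1: "gf (LO 1) f = gf (LE 2) (\<lambda>w. f (1 # w))"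
proof (rule fps_ext)
  fix k show "fps_nth (gf (LO 1) f) k = fps_nth (gf (LE 2) (\<lambda>w. f (1 # w))) k"
    by (cases k) (simp_all add: gf_def LE_def LO_def sum_phase1_Suc_Suc del: phase1.simps(3))
qed

text \<open>The equation determines the coefficients of each order from those of the previous order, up to the value at
\<open>g = 0\<close>.\<close>

lemma family_zero:
  fixes a :: "nat \<Rightarrow> real fps"
  assumes base: "a 0 = 0" and step: "\<And>g. a (Suc g) - a g = fps_X * a (g + 2)"
  shows "a g = 0"
proof -
  have "fps_nth (a g) k = 0" for k
  proof (induction k arbitrary: g)
    case 0
    show ?case
    proof (induction g)
      case (Suc g)
      have "fps_nth (a (Suc g) - a g) 0 = 0" by (simp add: step)
      then show ?case using Suc by simp
    qed (simp add: base)
  next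
    case (Suc k)
    show ?case
    proof (induction g)
      case (Suc g)
      have "fps_nth (a (Suc g) - a g) (Suc k) = 0" using \<open>\<And>g. fps_nth (a g) k = 0\<close> by (simp add: step)
      then show ?case using Suc by simp
    qed (simp add: base)
  qed
  then show ?thesis by (simp add: fps_eq_iff)
qed

text \<open>The coupled version for the two parities of the first phase.  Going around the coupling at \<open>g = 1\<close> once
raises the order, so the initial values are determined as well.\<close>

lemma family_zero2:
  fixes a b :: "nat \<Rightarrow> real fps"
  assumes stepa: "\<And>g. 1 \<le> g \<Longrightarrow> a (Suc g) - a g = fps_X * a (g + 2)"
    and stepb: "\<And>g. 1 \<le> g \<Longrightarrow> b (Suc g) - b g = fps_X * b (g + 2)"
    and basea: "a 1 = fps_X * b 2" and baseb: "b 1 = a 2"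
  shows "1 \<le> g \<Longrightarrow> a g = 0 \<and> b g = 0"
proof -
  have "\<forall>g\<ge>1. fps_nth (a g) k = 0 \<and> fps_nth (b g) k = 0" for k
  proof (induction k rule: less_induct)
    case (less k)
    have prev: "fps_nth (fps_X * a g) k = 0 \<and> fps_nth (fps_X * b g) k = 0" if "1 \<le> g" for g
      using less[of "k - 1"] that by (cases k) auto
    have sa: "fps_nth (a (Suc g)) k = fps_nth (a g) k" if "1 \<le> g" for g
      using arg_cong[OF stepa[OF that], of "\<lambda>F. fps_nth F k"] prev[of "g + 2"] by simp
    have sb: "fps_nth (b (Suc g)) k = fps_nth (b g) k" if "1 \<le> g" for g
      using arg_cong[OF stepb[OF that], of "\<lambda>F. fps_nth F k"] prev[of "g + 2"] by simp
    have A: "fps_nth (a g) k = 0" if "1 \<le> g" for g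
      using that by (induction g rule: dec_induct) (use basea prev[of 2] sa in auto)
    have B: "fps_nth (b g) k = 0" if "1 \<le> g" for g
      using that by (induction g rule: dec_induct) (use baseb A[of 2] sb in auto)
    show ?case using A B by simp
  qed
  then show "1 \<le> g \<Longrightarrow> a g = 0 \<and> b g = 0" by (simp add: fps_eq_iff)
qed

section \<open>Operations on represented statistics\<close>

text \<open>Horner scheme for \<open>\<Sum>\<^sub>t (n choose t) \<kappa>\<^sup>t f\<^sub>t\<close> over \<open>1 \<le> t \<le> n\<close>, where \<open>T\<close> implements multiplication by
\<open>\<kappa>\<close>.  By the binomial theorem this is the change of a power \<open>z\<^sup>n\<close> when \<open>z\<close> grows by \<open>\<kappa>\<close>.\<close>

fun chain :: "(bpoly \<Rightarrow> bpoly) \<Rightarrow> (nat \<Rightarrow> bpoly) \<Rightarrow> nat \<Rightarrow> nat \<Rightarrow> bpoly \<Rightarrow> bpoly" where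
  "chain T f n 0 acc = acc"
| "chain T f n (Suc t) acc = chain T f n t (T (badd acc (bscale (binom n (Suc t)) (f (Suc t)))))"

lemma chain_cong [fundef_cong]:
  assumes "T = T'" "n = n'" "m = m'" "acc = acc'" "\<And>t. 1 \<le> t \<Longrightarrow> t \<le> m' \<Longrightarrow> f t = f' t"
  shows "chain T f n m acc = chain T' f' n' m' acc'"
proof -
  have "chain T f n m acc = chain T f' n m acc" if "\<And>t. 1 \<le> t \<Longrightarrow> t \<le> m \<Longrightarrow> f t = f' t" for m acc
    using that by (induction m arbitrary: acc) auto
  then show ?thesis using assms by simp
qed

text \<open>The polynomial \<open>p\<close> describes the generating functions of the statistic \<open>f\<close> for all \<open>g \<ge> 1\<close>.  The exponent
\<open>r\<close> is 1 for words of odd length and 0 otherwise.\<close>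

definition rep :: "nat \<Rightarrow> (nat \<Rightarrow> nat \<Rightarrow> nat list set) \<Rightarrow> (nat \<Rightarrow> nat list \<Rightarrow> real) \<Rightarrow> bpoly \<Rightarrow> bool" where
  "rep r L f p \<longleftrightarrow> (\<forall>g\<ge>1. gf (L g) (f g) = Cat ^ (g + r) * beval p g)"

lemma rep_add: "rep r L f p \<Longrightarrow> rep r L h q \<Longrightarrow> rep r L (\<lambda>g w. f g w + h g w) (badd p q)"
  by (simp add: rep_def gf_add beval_at_badd algebra_simps)

lemma rep_zero: "rep r L (\<lambda>g w. 0) []"
  using gf_scale[of _ 0 "\<lambda>w. 0"] by (simp add: rep_def)

lemma fps_const_of_int: "fps_const (of_int k) = (of_int k :: real fps)"
  by (metis fps_of_int)

lemma rep_bscale: "rep r L f p \<Longrightarrow> rep r L (\<lambda>g w. of_int k * f g w) (bscale k p)"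
  by (simp add: rep_def gf_scale beval_at_bscale fps_const_of_int)

lemma rep_blinear: "rep r L f p \<Longrightarrow> rep r L (\<lambda>g w. (of_int s * real g + of_int c) * f g w) (blinear s c p)"
  by (simp add: rep_def gf_scale beval_blinear fps_const_of_int[symmetric] fps_of_nat[symmetric])

lemma rep_bchoose2:
  assumes "rep r L f p"
  shows "rep r L (\<lambda>g w. (real g - 1) * (real g - 2) / 2 * f g w) (bchoose2 p)"
proof -
  have "gf (L g) (\<lambda>w. (real g - 1) * (real g - 2) / 2 * f g w) = Cat ^ (g + r) * beval (bchoose2 p) g" if "1 \<le> g" for g
  proof -
    have c: "2 * ((real g - 1) * (real g - 2) / 2) = (real g - 1) * (real g - 2)" by simp
    have "2 * gf (L g) (\<lambda>w. (real g - 1) * (real g - 2) / 2 * f g w)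
        = fps_const 2 * (fps_const ((real g - 1) * (real g - 2) / 2) * gf (L g) (f g))"
      by (simp only: gf_scale fps_numeral_fps_const)
    also have "\<dots> = fps_const ((real g - 1) * (real g - 2)) * gf (L g) (f g)"
      by (simp only: mult.assoc[symmetric] fps_const_mult[of 2 "(real g - 1) * (real g - 2) / 2"] c)
    also have "\<dots> = (of_nat g - 1) * (of_nat g - 2) * (Cat ^ (g + r) * beval p g)"
      using assms that by (simp add: rep_def fps_of_nat[symmetric] fps_numeral_fps_const fps_const_1_eq_1[symmetric] del: fps_const_1_eq_1)
    also have "\<dots> = Cat ^ (g + r) * (2 * beval (bchoose2 p) g)" by (simp add: beval_bchoose2)
    finally have "2 * gf (L g) (\<lambda>w. (real g - 1) * (real g - 2) / 2 * f g w) = 2 * (Cat ^ (g + r) * beval (bchoose2 p) g)"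
      by (simp only: mult.left_commute)
    then show ?thesis by simp
  qed
  then show ?thesis by (simp add: rep_def)
qed

lemma rep_blength:
  assumes "rep r L f p" and "\<And>g k w. w \<in> L g k \<Longrightarrow> length w = 2 * k + r"
  shows "rep r L (\<lambda>g w. (real (length w) + 1) * f g w) (blength (int r) p)"
proof -
  have "gf (L g) (\<lambda>w. (real (length w) + 1) * f g w) = Cat ^ (g + r) * beval (blength (int r) p) g" if "1 \<le> g" for g
  proof -
    have "gf (L g) (\<lambda>w. (real (length w) + 1) * f g w)
        = 2 * theta (Cat ^ (g + r) * beval p g) + (1 + of_nat r) * (Cat ^ (g + r) * beval p g)"
      using gf_length[of "L g" r "f g"] assms that by (simp add: rep_def)
    also have "theta (Cat ^ (g + r) * beval p g) = Cat ^ (g + r) * (theta (beval p g) + of_nat (g + r) * yy * beval p g)"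
      by (simp add: theta_mult theta_Cat_power algebra_simps del: power_add of_nat_add)
    finally show ?thesis by (simp add: beval_blength algebra_simps)
  qed
  then show ?thesis by (simp add: rep_def)
qed

lemma rep_chain_aux:
  assumes T: "\<And>f p. rep r L f p \<Longrightarrow> rep r L (\<lambda>g w. \<kappa> g w * f g w) (T p)"
    and f: "\<And>t. 1 \<le> t \<Longrightarrow> t \<le> m \<Longrightarrow> rep r L (h t) (f t)" and a: "rep r L a acc"
  shows "rep r L (\<lambda>g w. \<kappa> g w ^ m * a g w + (\<Sum>t=1..m. real (n choose t) * \<kappa> g w ^ t * h t g w)) (chain T f n m acc)"
  using f a
proof (induction m arbitrary: a acc)
  case (Suc m)
  let ?a' = "\<lambda>g w. \<kappa> g w * (a g w + of_int (binom n (Suc m)) * h (Suc m) g w)"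
  have "rep r L ?a' (T (badd acc (bscale (binom n (Suc m)) (f (Suc m)))))"
    using Suc.prems by (intro T rep_add rep_bscale) auto
  from Suc.IH[OF _ this] Suc.prems(1)
  have "rep r L (\<lambda>g w. \<kappa> g w ^ m * ?a' g w + (\<Sum>t=1..m. real (n choose t) * \<kappa> g w ^ t * h t g w)) (chain T f n (Suc m) acc)"
    by simp
  moreover have "\<kappa> g w ^ m * ?a' g w + (\<Sum>t=1..m. real (n choose t) * \<kappa> g w ^ t * h t g w)
     = \<kappa> g w ^ Suc m * a g w + (\<Sum>t=1..Suc m. real (n choose t) * \<kappa> g w ^ t * h t g w)" for g w
    by (simp add: binom_eq algebra_simps)
  ultimately show ?case by (simp only:)
qed simp

lemma rep_chain:
  assumes T: "\<And>f p. rep r L f p \<Longrightarrow> rep r L (\<lambda>g w. \<kappa> g w * f g w) (T p)"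
    and f: "\<And>t. 1 \<le> t \<Longrightarrow> t \<le> n \<Longrightarrow> rep r L (h t) (f t)"
    and e: "\<And>g w. F g w - h0 g w = (\<Sum>t=1..n. real (n choose t) * \<kappa> g w ^ t * h t g w)"
  shows "rep r L (\<lambda>g w. F g w - h0 g w) (chain T f n n [])"
  using rep_chain_aux[OF T f rep_zero, where n = n and m = n] e by simp

lemma binomial_minus_leading:
  fixes a b c :: real
  shows "(a + b) ^ n * c - a ^ n * c = (\<Sum>t=1..n. real (n choose t) * b ^ t * (a ^ (n - t) * c))"
proof -
  have "(a + b) ^ n = (b + a) ^ n" by (simp add: add.commute)
  also have "\<dots> = (\<Sum>t\<le>n. real (n choose t) * b ^ t * a ^ (n - t))" by (rule binomial_ring)
  also have "\<dots> = a ^ n + (\<Sum>t=1..n. real (n choose t) * b ^ t * a ^ (n - t))"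
    by (simp add: atMost_atLeast0 sum.atLeast_Suc_atMost)
  finally show ?thesis by (simp add: algebra_simps sum_distrib_left)
qed

section \<open>Recursive computation of the moment polynomials\<close>

text \<open>A transparent version of let: with the weak congruence rule for this constant the rewriting engine evaluates the
bound term once, before substituting it.\<close>

definition share :: "'a \<Rightarrow> ('a \<Rightarrow> 'b) \<Rightarrow> 'b" where "share x f = f x"

text \<open>The polynomials of one monomial \<open>S\<^sup>i m\<^sup>j B\<^sup>l\<close> in the size, the total and the sum of binomial coefficients of
the letters, at the stages of the substitution that describes a new first block.  The block changes \<open>B\<close> to
\<open>B + (g - 1)(g - 2)/2\<close> (stage \<open>tH\<close>), then \<open>m\<close> to \<open>m + g + c\<close> (stage \<open>tG\<close>), then \<open>S\<close> successively by \<open>2B\<close> (stage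
\<open>tX\<close>), by \<open>(d - g) m\<close> (stage \<open>tZ\<close>), where \<open>B\<close> and \<open>m\<close> are the new values, and by a term that depends on the length
(stage \<open>tR\<close>).  Substituting in this order makes each stage a binomial expansion over entries of lower weight.\<close>

datatype moment_table = Tab (tP: bpoly) (tH: bpoly) (tG: bpoly) (tX: bpoly) (tZ: bpoly) (tR: bpoly)

text \<open>Each stage is computed up to the polynomial of the unchanged monomial, which is not known yet and is
added by \<open>addP\<close>.\<close>

definition stages :: "int \<Rightarrow> int \<Rightarrow> (bpoly \<Rightarrow> bpoly) \<Rightarrow> (nat \<Rightarrow> nat \<Rightarrow> nat \<Rightarrow> moment_table) \<Rightarrow> nat \<Rightarrow> nat \<Rightarrow> nat \<Rightarrow> moment_table" where
  "stages c d T F i j l =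
     share (chain bchoose2 (\<lambda>t. tP (F i j (l - t))) l l []) (\<lambda>H.
     share (badd H (chain (blinear 1 c) (\<lambda>t. tH (F i (j - t) l)) j j [])) (\<lambda>G.
     share (badd G (chain (bscale 2) (\<lambda>t. tG (F (i - t) j (l + t))) i i [])) (\<lambda>X.
     share (badd X (chain (blinear (-1) d) (\<lambda>t. tX (F (i - t) (j + t) l)) i i [])) (\<lambda>Z.
     share (badd Z (chain T (\<lambda>t. tZ (F (i - t) j l)) i i [])) (\<lambda>R.
       Tab [] H G X Z R)))))"

lemma stages_cong [fundef_cong]:
  assumes "c = c'" "d = d'" "T = T'" "i = i'" "j = j'" "l = l'"
    "\<And>a b e. 6 * a + 3 * b + 4 * e < 6 * i' + 3 * j' + 4 * l' \<Longrightarrow> F a b e = F' a b e"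
  shows "stages c d T F i j l = stages c' d' T' F' i' j' l'"
proof -
  have "stages c d T F i j l = stages c d T F' i j l"
    unfolding stages_def by (intro arg_cong2[of _ _ _ _ share] arg_cong2[of _ _ _ _ badd] ext chain_cong refl
      arg_cong[of _ _ tP] arg_cong[of _ _ tH] arg_cong[of _ _ tG] arg_cong[of _ _ tX] arg_cong[of _ _ tZ] assms(7))
      (use assms(1-6) in auto)
  then show ?thesis using assms by simp
qed

fun addP :: "bpoly \<Rightarrow> moment_table \<Rightarrow> moment_table" where
  "addP P (Tab P' H G X Z R) = Tab P (badd H P) (badd G P) (badd X P) (badd Z P) (badd R P)"

text \<open>The source term is the last stage without the unchanged monomial; solving the difference equation
gives the increments of \<open>P\<close>, hence \<open>P\<close>, whose value at \<open>g = 0\<close> is that of the empty word.\<close>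

definition finish_W :: "nat \<Rightarrow> moment_table \<Rightarrow> moment_table" where
  "finish_W k s = share (base0 (case k of 0 \<Rightarrow> [1] | Suc _ \<Rightarrow> []) (integ (bsolve (tR s)))) (\<lambda>P. addP P s)"

text \<open>Multiplication by the length-dependent term \<open>kW\<close>, and below by \<open>kE\<close>.\<close>

definition mul_kW :: "bpoly \<Rightarrow> bpoly" where "mul_kW p = bchoose2 (blength 0 p)"

text \<open>Every recursive call lowers \<open>6i + 3j + 4l\<close>: powers are traded from \<open>S\<close> to \<open>B\<close> and to \<open>m\<close>, or dropped.  These
weights are chosen so that \<open>B\<close> and \<open>m\<close> are both cheaper than \<open>S\<close>.\<close>

function tabW :: "nat \<Rightarrow> nat \<Rightarrow> nat \<Rightarrow> moment_table" where
  "tabW i j l = finish_W (i + (j + l)) (stages (-1) 3 mul_kW tabW i j l)"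
  by pat_completeness auto
termination
  by (relation "measure (\<lambda>(i, j, l). 6 * i + 3 * j + 4 * l)") auto

declare tabW.simps [simp del]

fun ysum_binom :: "(nat \<Rightarrow> ypoly) \<Rightarrow> nat \<Rightarrow> nat \<Rightarrow> ypoly" where
  "ysum_binom f n 0 = []"
| "ysum_binom f n (Suc t) = yadd (ysum_binom f n t) (yscale (binom n (Suc t)) (f (Suc t)))"

lemma ysum_binom_cong [fundef_cong]:
  assumes "n = n'" "m = m'" "\<And>t. 1 \<le> t \<Longrightarrow> t \<le> m' \<Longrightarrow> f t = f' t"
  shows "ysum_binom f n m = ysum_binom f' n' m'"
proof -
  have "ysum_binom f n m = ysum_binom f' n m" if "\<And>t. 1 \<le> t \<Longrightarrow> t \<le> m \<Longrightarrow> f t = f' t" for m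
    using that by (induction m) auto
  then show ?thesis using assms by simp
qed

text \<open>Putting a single letter 1 in front changes \<open>S\<close> to \<open>S + B\<close> and \<open>m\<close> to \<open>m + 1\<close>.  This is the sum of all terms
of the expansion except the leading one, at \<open>g = 2\<close>.\<close>

definition lower_terms :: "(nat \<Rightarrow> nat \<Rightarrow> nat \<Rightarrow> moment_table) \<Rightarrow> nat \<Rightarrow> nat \<Rightarrow> nat \<Rightarrow> ypoly" where
  "lower_terms F i j l = yadd (ysum_binom (\<lambda>t. ydot [1, 2, 1] (tP (F i (j - t) l))) j j)
     (ysum_binom (\<lambda>s. yadd (ydot [1, 2, 1] (tP (F (i - s) j (l + s))))
        (ysum_binom (\<lambda>t. ydot [1, 2, 1] (tP (F (i - s) (j - t) (l + s)))) j j)) i i)"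

lemma lower_terms_cong [fundef_cong]:
  assumes "i = i'" "j = j'" "l = l'"
    "\<And>a b e. 6 * a + 3 * b + 4 * e < 6 * i' + 3 * j' + 4 * l' \<Longrightarrow> F a b e = F' a b e"
  shows "lower_terms F i j l = lower_terms F' i' j' l'"
proof -
  have "lower_terms F i j l = lower_terms F' i j l"
    unfolding lower_terms_def by (intro arg_cong2[of _ _ _ _ yadd] ysum_binom_cong refl arg_cong2[of _ _ _ _ ydot]
      arg_cong[of _ _ tP] assms(4)) (use assms(1-3) in auto)
  then show ?thesis using assms by simp
qed

text \<open>The values \<open>e\<close> at \<open>g = 1\<close> for even length and \<open>e + a\<close> for odd length satisfy the coupled equations at
\<open>g = 1\<close>, in which \<open>e\<close> occurs on both sides with factor \<open>u\<close>.  Dividing by \<open>1 - u\<close> turns \<open>u\<close> into \<open>y\<close> and 1 into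
\<open>1 + y\<close>.\<close>

definition finish_EO :: "moment_table \<Rightarrow> moment_table \<Rightarrow> moment_table \<Rightarrow> ypoly \<Rightarrow> ypoly \<Rightarrow> moment_table \<times> moment_table" where
  "finish_EO w se so le lo =
     share (bsolve (badd (tR se) (tR w))) (\<lambda>dE. share (bsolve (tR so)) (\<lambda>dO.
     share (ydot [1, 1] (tP w)) (\<lambda>w1. share (yadd (ydot [1, 3, 3, 1] dE) le) (\<lambda>a.
     share (yadd (0 # yadd (yadd a (yadd (ydot [1, 3, 3, 1] dO) lo)) w1) w1) (\<lambda>e.
       (addP (base1 e (integ dE)) se, addP (base1 (yadd e a) (integ dO)) so))))))"

definition mul_kE :: "int \<Rightarrow> bpoly \<Rightarrow> bpoly" where "mul_kE r p = badd (bchoose2 (blength r p)) (blinear 1 (-2) p)"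

function tabEO :: "nat \<Rightarrow> nat \<Rightarrow> nat \<Rightarrow> moment_table \<times> moment_table" where
  "tabEO i j l = finish_EO (tabW i j l)
     (stages 0 2 (mul_kE 0) (\<lambda>a b c. fst (tabEO a b c)) i j l)
     (stages 0 2 (mul_kE 1) (\<lambda>a b c. snd (tabEO a b c)) i j l)
     (lower_terms (\<lambda>a b c. fst (tabEO a b c)) i j l) (lower_terms (\<lambda>a b c. snd (tabEO a b c)) i j l)"
  by pat_completeness auto
termination
  by (relation "measure (\<lambda>(i, j, l). 6 * i + 3 * j + 4 * l)") auto

declare tabEO.simps [simp del]

section \<open>Correctness of the recursion\<close>

text \<open>The order of the arguments is size, total, sum of binomial coefficients.\<close>

definition monomial :: "nat \<Rightarrow> nat \<Rightarrow> nat \<Rightarrow> real \<Rightarrow> real \<Rightarrow> real \<Rightarrow> real" where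
  "monomial i j l s m b = s ^ i * m ^ j * b ^ l"

text \<open>The statistics after the successive substitutions.  The constants \<open>c\<close> and \<open>d\<close> depend on the floor, and \<open>g\<close> is
the bound for the letter after the new block.\<close>

definition B1 :: "nat \<Rightarrow> nat list \<Rightarrow> real" where "B1 g w = choose2_sum w + (real g - 1) * (real g - 2) / 2"
definition M1 :: "int \<Rightarrow> nat \<Rightarrow> nat list \<Rightarrow> real" where "M1 c g w = total w + (real g + of_int c)"
definition S1 :: "nat \<Rightarrow> nat list \<Rightarrow> real" where "S1 g w = word_size w + 2 * B1 g w"
definition S2 :: "int \<Rightarrow> int \<Rightarrow> nat \<Rightarrow> nat list \<Rightarrow> real" where
  "S2 c d g w = S1 g w + (of_int d - real g) * M1 c g w"

definition stat where "stat i j l w = monomial i j l (word_size w) (total w) (choose2_sum w)"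
text \<open>The monomial at the stages described at \<open>moment_table\<close>.\<close>

abbreviation fP :: "nat \<Rightarrow> nat \<Rightarrow> nat \<Rightarrow> nat \<Rightarrow> nat list \<Rightarrow> real" where "fP i j l \<equiv> \<lambda>g. stat i j l"
definition fH where "fH i j l g w = monomial i j l (word_size w) (total w) (B1 g w)"
definition fG where "fG c i j l g w = monomial i j l (word_size w) (M1 c g w) (B1 g w)"
definition fX where "fX c i j l g w = monomial i j l (S1 g w) (M1 c g w) (B1 g w)"
definition fZ where "fZ c d i j l g w = monomial i j l (S2 c d g w) (M1 c g w) (B1 g w)"
definition fR where "fR c d \<kappa> i j l g w = monomial i j l (S2 c d g w + \<kappa> g w) (M1 c g w) (B1 g w)"

definition table_correct where
  "table_correct r L c d \<kappa> i j l tb \<longleftrightarrow>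
     rep r L (fP i j l) (tP tb) \<and> rep r L (fH i j l) (tH tb) \<and> rep r L (fG c i j l) (tG tb)
     \<and> rep r L (fX c i j l) (tX tb) \<and> rep r L (fZ c d i j l) (tZ tb) \<and> rep r L (fR c d \<kappa> i j l) (tR tb)"

text \<open>Correctness of the stages before the unchanged monomial has been added.\<close>

definition table_diff_correct where
  "table_diff_correct r L c d \<kappa> i j l tb \<longleftrightarrow>
     rep r L (\<lambda>g w. fH i j l g w - fP i j l g w) (tH tb) \<and> rep r L (\<lambda>g w. fG c i j l g w - fP i j l g w) (tG tb)
     \<and> rep r L (\<lambda>g w. fX c i j l g w - fP i j l g w) (tX tb) \<and> rep r L (\<lambda>g w. fZ c d i j l g w - fP i j l g w) (tZ tb)
     \<and> rep r L (\<lambda>g w. fR c d \<kappa> i j l g w - fP i j l g w) (tR tb)"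

lemma rep_sub_add:
  assumes "rep r L (\<lambda>g w. f g w - h g w) p" "rep r L h q"
  shows "rep r L f (badd p q)"
  using rep_add[OF assms] by simp

lemma rep_telescope:
  assumes "rep r L (\<lambda>g w. f g w - h g w) p" "rep r L (\<lambda>g w. k g w - f g w) q"
  shows "rep r L (\<lambda>g w. k g w - h g w) (badd p q)"
  using rep_add[OF assms] by simp

lemma table_correct_addP:
  assumes "table_diff_correct r L c d \<kappa> i j l s" "rep r L (fP i j l) P"
  shows "table_correct r L c d \<kappa> i j l (addP P s)"
  using assms unfolding table_diff_correct_def table_correct_def
  by (cases s) (auto intro: rep_sub_add)

text \<open>Each stage changes only one of the three statistics, so it differs from the previous one by the lower
terms of a binomial expansion, and the differences telescope.\<close>

lemma table_diff_correct_stages: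
  assumes T: "\<And>f p. rep r L f p \<Longrightarrow> rep r L (\<lambda>g w. \<kappa> g w * f g w) (T p)"
    and F: "\<And>a b e. 6 * a + 3 * b + 4 * e < 6 * i + 3 * j + 4 * l \<Longrightarrow> table_correct r L c d \<kappa> a b e (F a b e)"
  shows "table_diff_correct r L c d \<kappa> i j l (stages c d T F i j l)"
proof -
  define H where "H = chain bchoose2 (\<lambda>t. tP (F i j (l - t))) l l []"
  define G where "G = badd H (chain (blinear 1 c) (\<lambda>t. tH (F i (j - t) l)) j j [])"
  define X where "X = badd G (chain (bscale 2) (\<lambda>t. tG (F (i - t) j (l + t))) i i [])"
  define Z where "Z = badd X (chain (blinear (-1) d) (\<lambda>t. tX (F (i - t) (j + t) l)) i i [])"
  define R where "R = badd Z (chain T (\<lambda>t. tZ (F (i - t) j l)) i i [])"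
  have stages: "stages c d T F i j l = Tab [] H G X Z R"
    by (simp add: stages_def share_def H_def G_def X_def Z_def R_def)
  have rH: "rep r L (\<lambda>g w. fH i j l g w - fP i j l g w) H"
    unfolding H_def
  proof (rule rep_chain[where h = "\<lambda>t. fP i j (l - t)" and \<kappa> = "\<lambda>g w. (real g - 1) * (real g - 2) / 2"])
    show "rep r L (fP i j (l - t)) (tP (F i j (l - t)))" if "1 \<le> t" "t \<le> l" for t
      using F[of i j "l - t"] that by (simp add: table_correct_def)
    show "fH i j l g w - fP i j l g w = (\<Sum>t=1..l. real (l choose t) * ((real g - 1) * (real g - 2) / 2) ^ t * fP i j (l - t) g w)" for g w
      using binomial_minus_leading[of "choose2_sum w" "(real g - 1) * (real g - 2) / 2" l "word_size w ^ i * total w ^ j"]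
      by (simp add: fH_def stat_def monomial_def B1_def algebra_simps)
  qed (rule rep_bchoose2)
  have "rep r L (\<lambda>g w. fG c i j l g w - fH i j l g w) (chain (blinear 1 c) (\<lambda>t. tH (F i (j - t) l)) j j [])"
  proof (rule rep_chain[where h = "\<lambda>t. fH i (j - t) l" and \<kappa> = "\<lambda>g w. real g + of_int c"])
    show "rep r L (fH i (j - t) l) (tH (F i (j - t) l))" if "1 \<le> t" "t \<le> j" for t
      using F[of i "j - t" l] that by (simp add: table_correct_def)
    show "rep r L (\<lambda>g w. (real g + of_int c) * f g w) (blinear 1 c p)" if "rep r L f p" for f p
      using rep_blinear[OF that, of 1 c] by simp
    show "fG c i j l g w - fH i j l g w = (\<Sum>t=1..j. real (j choose t) * (real g + of_int c) ^ t * fH i (j - t) l g w)" for g w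
      using binomial_minus_leading[of "total w" "real g + of_int c" j "word_size w ^ i * B1 g w ^ l"]
      by (simp add: fH_def fG_def monomial_def M1_def mult_ac)
  qed
  then have rG: "rep r L (\<lambda>g w. fG c i j l g w - fP i j l g w) G"
    unfolding G_def by (rule rep_telescope[OF rH])
  have "rep r L (\<lambda>g w. fX c i j l g w - fG c i j l g w) (chain (bscale 2) (\<lambda>t. tG (F (i - t) j (l + t))) i i [])"
  proof (rule rep_chain[where h = "\<lambda>t. fG c (i - t) j (l + t)" and \<kappa> = "\<lambda>g w. 2"])
    show "rep r L (fG c (i - t) j (l + t)) (tG (F (i - t) j (l + t)))" if "1 \<le> t" "t \<le> i" for t
      using F[of "i - t" j "l + t"] that by (simp add: table_correct_def)
    show "rep r L (\<lambda>g w. 2 * f g w) (bscale 2 p)" if "rep r L f p" for f p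
      using rep_bscale[OF that, of 2] by simp
    show "fX c i j l g w - fG c i j l g w = (\<Sum>t=1..i. real (i choose t) * 2 ^ t * fG c (i - t) j (l + t) g w)" for g w
      using binomial_minus_leading[of "word_size w" "2 * B1 g w" i "M1 c g w ^ j * B1 g w ^ l"]
      by (simp add: fX_def fG_def monomial_def S1_def mult_ac power_mult_distrib power_add)
  qed
  then have rX: "rep r L (\<lambda>g w. fX c i j l g w - fP i j l g w) X"
    unfolding X_def by (rule rep_telescope[OF rG])
  have "rep r L (\<lambda>g w. fZ c d i j l g w - fX c i j l g w) (chain (blinear (-1) d) (\<lambda>t. tX (F (i - t) (j + t) l)) i i [])"
  proof (rule rep_chain[where h = "\<lambda>t. fX c (i - t) (j + t) l" and \<kappa> = "\<lambda>g w. of_int d - real g"])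
    show "rep r L (fX c (i - t) (j + t) l) (tX (F (i - t) (j + t) l))" if "1 \<le> t" "t \<le> i" for t
      using F[of "i - t" "j + t" l] that by (simp add: table_correct_def)
    show "rep r L (\<lambda>g w. (of_int d - real g) * f g w) (blinear (-1) d p)" if "rep r L f p" for f p
      using rep_blinear[OF that, of "-1" d] by simp
    show "fZ c d i j l g w - fX c i j l g w = (\<Sum>t=1..i. real (i choose t) * (of_int d - real g) ^ t * fX c (i - t) (j + t) l g w)" for g w
      using binomial_minus_leading[of "S1 g w" "(of_int d - real g) * M1 c g w" i "M1 c g w ^ j * B1 g w ^ l"]
      by (simp add: fX_def fZ_def monomial_def S2_def mult_ac power_mult_distrib power_add)
  qed
  then have rZ: "rep r L (\<lambda>g w. fZ c d i j l g w - fP i j l g w) Z"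
    unfolding Z_def by (rule rep_telescope[OF rX])
  have "rep r L (\<lambda>g w. fR c d \<kappa> i j l g w - fZ c d i j l g w) (chain T (\<lambda>t. tZ (F (i - t) j l)) i i [])"
  proof (rule rep_chain[where h = "\<lambda>t. fZ c d (i - t) j l" and \<kappa> = \<kappa>, OF T])
    show "rep r L (fZ c d (i - t) j l) (tZ (F (i - t) j l))" if "1 \<le> t" "t \<le> i" for t
      using F[of "i - t" j l] that by (simp add: table_correct_def)
    show "fR c d \<kappa> i j l g w - fZ c d i j l g w = (\<Sum>t=1..i. real (i choose t) * \<kappa> g w ^ t * fZ c d (i - t) j l g w)" for g w
      using binomial_minus_leading[of "S2 c d g w" "\<kappa> g w" i "M1 c g w ^ j * B1 g w ^ l"]
      by (simp add: fR_def fZ_def monomial_def mult_ac)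
  qed
  then have rR: "rep r L (\<lambda>g w. fR c d \<kappa> i j l g w - fP i j l g w) R"
    unfolding R_def by (rule rep_telescope[OF rZ])
  show ?thesis using rH rG rX rZ rR by (simp add: stages table_diff_correct_def)
qed

text \<open>What remains of the change of size after the stage \<open>tZ\<close>, for the floors 0 and 1; it is the only part that
involves the length of the word.\<close>

definition kW :: "nat \<Rightarrow> nat list \<Rightarrow> real" where
  "kW g w = (real g - 1) * (real g - 2) / 2 * (real (length w) + 1)"
definition kE :: "nat \<Rightarrow> nat list \<Rightarrow> real" where
  "kE g w = (real g - 1) * (real g - 2) / 2 * (real (length w) + 1) + (real g - 2)"

text \<open>With \<open>g\<close> shifted by 2 the bound after the block agrees with the parameter of the family in the difference
equation.\<close>

lemma stat_prepend_W: "stat i j l (0 # Suc g # w) = fR (-1) 3 kW i j l (g + 2) w"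
proof -
  have s: "word_size (0 # Suc g # w) = S2 (-1) 3 (g + 2) w + kW (g + 2) w"
    by (simp add: word_size_Cons S2_def S1_def B1_def M1_def kW_def field_simps del: word_size.simps)
  have m: "total (0 # Suc g # w) = M1 (-1) (g + 2) w" by (simp add: M1_def)
  have b: "choose2_sum (0 # Suc g # w) = B1 (g + 2) w" by (simp add: B1_def)
  show ?thesis unfolding stat_def fR_def s m b ..
qed

lemma stat_prepend_E: "stat i j l (1 # Suc g # w) = fR 0 2 kE i j l (g + 2) w"
proof -
  have s: "word_size (1 # Suc g # w) = S2 0 2 (g + 2) w + kE (g + 2) w"
    by (simp add: word_size_Cons S2_def S1_def B1_def M1_def kE_def field_simps del: word_size.simps)
  have m: "total (1 # Suc g # w) = M1 0 (g + 2) w" by (simp add: M1_def)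
  have b: "choose2_sum (1 # Suc g # w) = B1 (g + 2) w" by (simp add: B1_def)
  show ?thesis unfolding stat_def fR_def s m b ..
qed

text \<open>The difference equation for \<open>C\<^sup>g P(g)\<close>, divided by \<open>C\<^sup>g\<close>: since \<open>x C\<^sup>2 = u = C - 1\<close>, it says that the
increments \<open>D\<close> of \<open>P\<close> satisfy \<open>D = u (D' + \<rho>)\<close>, which is solved by \<open>bsolve\<close>.\<close>

lemma Cat_step:
  assumes D: "D = uu * (D' + \<rho>)" and 1: "P1 = P0 + D" and 2: "P2 = P1 + D'"
  shows "Cat * P1 - P0 = fps_X * Cat ^ 2 * (P2 + \<rho>)"
proof -
  have "Cat * P1 - P0 = uu * P1 + D" by (simp add: 1 uu_def algebra_simps)
  also have "\<dots> = uu * P1 + uu * (D' + \<rho>)" using D by simp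
  also have "\<dots> = uu * (P2 + \<rho>)" by (simp add: 2 algebra_simps)
  finally show ?thesis by (simp add: X_Cat)
qed

lemma Cat_step_power:
  assumes "D = uu * (D' + \<rho>)" and "P1 = P0 + D" and "P2 = P1 + D'"
  shows "Cat ^ Suc n * P1 - Cat ^ n * P0 = fps_X * (Cat ^ (n + 2) * P2 + Cat ^ (n + 2) * \<rho>)"
proof -
  have "Cat ^ Suc n * P1 - Cat ^ n * P0 = Cat ^ n * (Cat * P1 - P0)" by (simp add: algebra_simps)
  also have "\<dots> = Cat ^ n * (fps_X * Cat ^ 2 * (P2 + \<rho>))" by (simp only: Cat_step[OF assms])
  finally show ?thesis by (simp add: power_add power2_eq_square algebra_simps)
qed

lemma solution_step:
  assumes "\<And>g. beval P (Suc g) = beval P g + beval (bsolve \<rho>) (g + 2)"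
  shows "Cat ^ Suc n * beval P (Suc g) - Cat ^ n * beval P g = fps_X * (Cat ^ (n + 2) * beval P (g + 2) + Cat ^ (n + 2) * beval \<rho> (g + 2))"
proof (rule Cat_step_power)
  show "beval (bsolve \<rho>) (g + 2) = uu * (beval (bsolve \<rho>) (Suc (g + 2)) + beval \<rho> (g + 2))" by (rule beval_bsolve)
  show "beval P (Suc g) = beval P g + beval (bsolve \<rho>) (g + 2)" by (rule assms)
  show "beval P (g + 2) = beval P (Suc g) + beval (bsolve \<rho>) (Suc (g + 2))" using assms[of "Suc g"] by simp
qed

text \<open>The difference between the generating function and the claimed solution satisfies the homogeneous
equation with initial value zero.\<close>

lemma rep_W_solution:
  assumes \<rho>: "rep 0 LW (\<lambda>g w. fR (-1) 3 kW i j l g w - fP i j l g w) \<rho>"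
    and init: "yeval a = of_nat (0 ^ (i + (j + l)))"
  shows "rep 0 LW (fP i j l) (base0 a (integ (bsolve \<rho>)))"
proof -
  let ?P = "base0 a (integ (bsolve \<rho>))"
  define f where "f = stat i j l"
  define A where "A g = gf (LW g) f - Cat ^ g * beval ?P g" for g
  have Pstep: "beval ?P (Suc g) = beval ?P g + beval (bsolve \<rho>) (g + 2)" for g
    by (simp only: beval_base0 beval_integ) simp
  have src: "gf (LW (g + 2)) (\<lambda>w. f (0 # Suc g # w)) = gf (LW (g + 2)) f + Cat ^ (g + 2) * beval \<rho> (g + 2)" for g
  proof -
    have "gf (LW (g + 2)) (\<lambda>w. f (0 # Suc g # w)) = gf (LW (g + 2)) (fR (-1) 3 kW i j l (g + 2))"
      by (simp only: f_def stat_prepend_W)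
    also have "\<dots> = gf (LW (g + 2)) (stat i j l) + gf (LW (g + 2)) (\<lambda>w. fR (-1) 3 kW i j l (g + 2) w - stat i j l w)"
      by (simp add: gf_add[symmetric])
    finally show ?thesis using \<rho> by (simp add: rep_def f_def)
  qed
  have "A g = 0" for g
  proof (rule family_zero)
    have "f [] = 0 ^ (i + (j + l))" by (simp add: f_def stat_def monomial_def power_add)
    then have "fps_const (f []) = yeval a" by (simp add: init fps_of_nat[symmetric])
    then show "A 0 = 0" by (simp add: A_def gfW_0 beval_base0)
    show "A (Suc g) - A g = fps_X * A (g + 2)" for g
    proof -
      have "A (Suc g) - A g = (gf (LW (Suc g)) f - gf (LW g) f) - (Cat ^ Suc g * beval ?P (Suc g) - Cat ^ g * beval ?P g)"
        by (simp add: A_def)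
      also have "\<dots> = fps_X * (gf (LW (g + 2)) f + Cat ^ (g + 2) * beval \<rho> (g + 2))
          - fps_X * (Cat ^ (g + 2) * beval ?P (g + 2) + Cat ^ (g + 2) * beval \<rho> (g + 2))"
        by (simp only: gfW_Suc src solution_step[OF Pstep])
      finally show ?thesis by (simp add: A_def algebra_simps)
    qed
  qed
  then show ?thesis by (simp add: rep_def A_def f_def)
qed

lemma tabW_correct: "table_correct 0 LW (-1) 3 kW i j l (tabW i j l)"
proof (induction "6 * i + 3 * j + 4 * l" arbitrary: i j l rule: less_induct)
  case less
  let ?s = "stages (-1) 3 mul_kW tabW i j l"
  let ?a = "case i + (j + l) of 0 \<Rightarrow> [1] | Suc _ \<Rightarrow> []"
  have T: "rep 0 LW (\<lambda>g w. kW g w * f g w) (mul_kW p)" if "rep 0 LW f p" for f p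
  proof -
    have "rep 0 LW (\<lambda>g w. (real (length w) + 1) * f g w) (blength 0 p)"
      using rep_blength[OF that] by (simp add: LW_def length_phase2)
    from rep_bchoose2[OF this] show ?thesis by (simp add: mul_kW_def kW_def mult.assoc)
  qed
  have s: "table_diff_correct 0 LW (-1) 3 kW i j l ?s" by (rule table_diff_correct_stages[OF T less])
  have "rep 0 LW (fP i j l) (base0 ?a (integ (bsolve (tR ?s))))"
    by (rule rep_W_solution) (use s in \<open>auto simp: table_diff_correct_def split: nat.split\<close>)
  from table_correct_addP[OF s this] show ?case
    by (subst tabW.simps) (simp add: finish_W_def share_def)
qed

lemma lower_terms_sum:
  assumes F: "\<And>a b e. 6 * a + 3 * b + 4 * e < 6 * i + 3 * j + 4 * l \<Longrightarrow> rep r L (fP a b e) (tP (F a b e))"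
  shows "gf (L 2) (\<lambda>w. stat i j l (1 # w)) = gf (L 2) (stat i j l) + Cat ^ (2 + r) * yeval (lower_terms F i j l)"
proof -
  define q where "q a b e w = stat a b e w" for a b e w
  have ysum_binom: "yeval (ysum_binom f n m) = (\<Sum>t=1..m. of_nat (n choose t) * yeval (f t))" for f n m
    by (induction m) (simp_all add: binom_eq)
  have q: "gf (L 2) (q a b e) = Cat ^ (2 + r) * yeval (ydot [1, 2, 1] (tP (F a b e)))"
    if "6 * a + 3 * b + 4 * e < 6 * i + 3 * j + 4 * l" for a b e
    using F[OF that] by (simp add: rep_def q_def[abs_def] ydot_121)
  have e: "stat i j l (1 # w) =
      (\<Sum>s\<le>i. \<Sum>t\<le>j. real (i choose s) * (real (j choose t) * q (i - s) (j - t) (l + s) w))" for w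
  proof -
    have "stat i j l (1 # w) = (choose2_sum w + word_size w) ^ i * (1 + total w) ^ j * choose2_sum w ^ l"
      by (simp add: stat_def monomial_def word_size_Cons add_ac del: word_size.simps)
    also have "\<dots> = (\<Sum>s\<le>i. real (i choose s) * choose2_sum w ^ s * word_size w ^ (i - s))
        * (\<Sum>t\<le>j. real (j choose t) * 1 ^ t * total w ^ (j - t)) * choose2_sum w ^ l"
      by (simp only: binomial_ring)
    also have "\<dots> = (\<Sum>s\<le>i. \<Sum>t\<le>j. real (i choose s) * (real (j choose t) * q (i - s) (j - t) (l + s) w))"
      by (simp add: sum_product sum_distrib_right sum_distrib_left q_def stat_def monomial_def power_add mult_ac)
    finally show ?thesis .
  qed
  define Q where "Q s t = Cat ^ (2 + r) * yeval (ydot [1, 2, 1] (tP (F (i - s) (j - t) (l + s))))" for s t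
  have Q: "gf (L 2) (q (i - s) (j - t) (l + s)) = Q s t" if "s \<le> i" "t \<le> j" "(s, t) \<noteq> (0, 0)" for s t
    unfolding Q_def by (rule q) (use that in auto)
  have "gf (L 2) (\<lambda>w. stat i j l (1 # w)) =
      (\<Sum>s\<le>i. \<Sum>t\<le>j. of_nat (i choose s) * (of_nat (j choose t) * gf (L 2) (q (i - s) (j - t) (l + s))))"
    by (simp only: e gf_sum gf_scale fps_of_nat)
  also have "\<dots> = (\<Sum>t\<le>j. of_nat (j choose t) * gf (L 2) (q i (j - t) l))
      + (\<Sum>s=1..i. \<Sum>t\<le>j. of_nat (i choose s) * (of_nat (j choose t) * gf (L 2) (q (i - s) (j - t) (l + s))))"
    by (simp add: atMost_atLeast0 sum.atLeast_Suc_atMost[of 0 i])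
  also have "(\<Sum>t\<le>j. of_nat (j choose t) * gf (L 2) (q i (j - t) l))
      = gf (L 2) (q i j l) + (\<Sum>t=1..j. of_nat (j choose t) * Q 0 t)"
    using Q[of 0] by (simp add: atMost_atLeast0 sum.atLeast_Suc_atMost[of 0 j])
  also have "(\<Sum>s=1..i. \<Sum>t\<le>j. of_nat (i choose s) * (of_nat (j choose t) * gf (L 2) (q (i - s) (j - t) (l + s))))
      = (\<Sum>s=1..i. of_nat (i choose s) * (Q s 0 + (\<Sum>t=1..j. of_nat (j choose t) * Q s t)))"
    by (rule sum.cong[OF refl]) (simp add: atMost_atLeast0 sum.atLeast_Suc_atMost[of 0 j] Q sum_distrib_left distrib_left)
  also have "gf (L 2) (q i j l) + (\<Sum>t=1..j. of_nat (j choose t) * Q 0 t)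
      + (\<Sum>s=1..i. of_nat (i choose s) * (Q s 0 + (\<Sum>t=1..j. of_nat (j choose t) * Q s t)))
      = gf (L 2) (q i j l) + Cat ^ (2 + r) * yeval (lower_terms F i j l)"
    by (simp add: lower_terms_def ysum_binom Q_def sum_distrib_left distrib_left mult.left_commute)
  finally show ?thesis by (simp add: q_def[abs_def])
qed

text \<open>As for the second phase, but the two parities satisfy the homogeneous equations jointly.  Words of even
length receive an additional source from the transition to the second phase.\<close>

lemma EO_solution:
  fixes i j l :: nat
  defines "f \<equiv> stat i j l"
  assumes \<rho>E: "rep 0 LE (\<lambda>g w. fR 0 2 kE i j l g w - fP i j l g w) \<rho>E"
    and \<rho>W: "rep 0 LW (fR (-1) 3 kW i j l) \<rho>W"
    and \<rho>O: "rep 1 LO (\<lambda>g w. fR 0 2 kE i j l g w - fP i j l g w) \<rho>O"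
    and W: "rep 0 LW (fP i j l) pW"
    and le: "gf (LE 2) (\<lambda>w. f (1 # w)) = gf (LE 2) f + Cat ^ 2 * yeval le"
    and lo: "gf (LO 2) (\<lambda>w. f (1 # w)) = gf (LO 2) f + Cat ^ 3 * yeval lo"
    and stepE: "\<And>g. beval PE (Suc g) = beval PE g + beval (bsolve (badd \<rho>E \<rho>W)) (g + 2)"
    and stepO: "\<And>g. beval PO (Suc g) = beval PO g + beval (bsolve \<rho>O) (g + 2)"
    and bE: "beval PE 1 = uu * (beval PO 2 + yeval lo) + beval pW 1"
    and bO: "beval PO 1 = beval PE 2 + yeval le"
    and g: "1 \<le> g"
  shows "gf (LE g) f = Cat ^ g * beval PE g \<and> gf (LO g) f = Cat ^ (g + 1) * beval PO g"
proof -
  define A where "A g = gf (LE g) f - Cat ^ g * beval PE g" for g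
  define B where "B g = gf (LO g) f - Cat ^ (g + 1) * beval PO g" for g
  have split: "gf L (fR 0 2 kE i j l (g + 2)) = gf L f + gf L (\<lambda>w. fR 0 2 kE i j l (g + 2) w - stat i j l w)" for L g
    by (simp add: gf_add[symmetric] f_def)
  have srcE: "gf (LE (g + 2)) (\<lambda>w. f (1 # Suc g # w)) + gf (LW (g + 2)) (\<lambda>w. f (0 # Suc g # w))
      = gf (LE (g + 2)) f + Cat ^ (g + 2) * beval (badd \<rho>E \<rho>W) (g + 2)" for g
    using \<rho>E \<rho>W split[of "LE (g + 2)" g]
    by (simp add: f_def stat_prepend_E stat_prepend_W rep_def beval_at_badd algebra_simps del: One_nat_def)
  have srcO: "gf (LO (g + 2)) (\<lambda>w. f (1 # Suc g # w)) = gf (LO (g + 2)) f + Cat ^ (g + 3) * beval \<rho>O (g + 2)" for g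
    using \<rho>O split[of "LO (g + 2)" g]
    by (simp add: f_def stat_prepend_E rep_def numeral_3_eq_3 power_add del: One_nat_def)
  have "A g = 0 \<and> B g = 0"
  proof (rule family_zero2[OF _ _ _ _ g])
    show "A (Suc g) - A g = fps_X * A (g + 2)" if "1 \<le> g" for g
    proof -
      have "A (Suc g) - A g = (gf (LE (Suc g)) f - gf (LE g) f) - (Cat ^ Suc g * beval PE (Suc g) - Cat ^ g * beval PE g)"
        by (simp add: A_def)
      also have "\<dots> = fps_X * (gf (LE (g + 2)) f + Cat ^ (g + 2) * beval (badd \<rho>E \<rho>W) (g + 2))
          - fps_X * (Cat ^ (g + 2) * beval PE (g + 2) + Cat ^ (g + 2) * beval (badd \<rho>E \<rho>W) (g + 2))"
        by (simp only: gfE_Suc[OF that] srcE solution_step[OF stepE])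
      finally show ?thesis by (simp add: A_def algebra_simps)
    qed
    show "B (Suc g) - B g = fps_X * B (g + 2)" if "1 \<le> g" for g
    proof -
      have "B (Suc g) - B g = (gf (LO (Suc g)) f - gf (LO g) f)
          - (Cat ^ Suc (g + 1) * beval PO (Suc g) - Cat ^ (g + 1) * beval PO g)"
        by (simp add: B_def)
      also have "\<dots> = fps_X * (gf (LO (g + 2)) f + Cat ^ (g + 3) * beval \<rho>O (g + 2))
          - fps_X * (Cat ^ (g + 1 + 2) * beval PO (g + 2) + Cat ^ (g + 1 + 2) * beval \<rho>O (g + 2))"
        by (simp only: gfO_Suc[OF that] srcO solution_step[OF stepO])
      finally show ?thesis by (simp add: B_def numeral_3_eq_3 algebra_simps)
    qed
    show "A 1 = fps_X * B 2"
    proof -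
      have "gf (LW 1) f = Cat * beval pW 1" using W by (simp add: rep_def f_def)
      then have "A 1 = fps_X * (gf (LO 2) f + Cat ^ 3 * yeval lo) + Cat * beval pW 1 - Cat * (fps_X * Cat ^ 2 * (beval PO 2 + yeval lo) + beval pW 1)"
        by (simp only: A_def gfE_1 lo bE X_Cat[symmetric] power_one_right)
      then show ?thesis by (simp add: B_def algebra_simps power2_eq_square power3_eq_cube)
    qed
    show "B 1 = A 2" by (simp only: A_def B_def gfO_1 le bO) (simp add: algebra_simps power2_eq_square)
  qed
  then show ?thesis by (simp add: A_def B_def)
qed

text \<open>The polynomials solve the difference equations by construction; what remains is that their values at
\<open>g = 1\<close> solve the coupled linear equations.\<close>

lemma tabEO_correct:
  "table_correct 0 LE 0 2 kE i j l (fst (tabEO i j l)) \<and> table_correct 1 LO 0 2 kE i j l (snd (tabEO i j l))"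
proof (induction "6 * i + 3 * j + 4 * l" arbitrary: i j l rule: less_induct)
  case less
  define FE where "FE = (\<lambda>a b c. fst (tabEO a b c))"
  define FO where "FO = (\<lambda>a b c. snd (tabEO a b c))"
  define sE where "sE = stages 0 2 (mul_kE 0) FE i j l"
  define sO where "sO = stages 0 2 (mul_kE 1) FO i j l"
  define w where "w = tabW i j l"
  define le where "le = lower_terms FE i j l"
  define lo where "lo = lower_terms FO i j l"
  define dE where "dE = bsolve (badd (tR sE) (tR w))"
  define dO where "dO = bsolve (tR sO)"
  define w1 where "w1 = ydot [1, 1] (tP w)"
  define a where "a = yadd (ydot [1, 3, 3, 1] dE) le"
  define e where "e = yadd (0 # yadd (yadd a (yadd (ydot [1, 3, 3, 1] dO) lo)) w1) w1"
  define PE where "PE = base1 e (integ dE)"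
  define PO where "PO = base1 (yadd e a) (integ dO)"
  have moment_table: "tabEO i j l = (addP PE sE, addP PO sO)"
    unfolding PE_def PO_def e_def a_def w1_def dE_def dO_def le_def lo_def sE_def sO_def w_def FE_def FO_def
    by (rule trans[OF tabEO.simps]) (unfold finish_EO_def share_def, rule refl)
  have lowE: "table_correct 0 LE 0 2 kE a b c (FE a b c)" and lowO: "table_correct 1 LO 0 2 kE a b c (FO a b c)"
    if "6 * a + 3 * b + 4 * c < 6 * i + 3 * j + 4 * l" for a b c
    using less[OF that] by (simp_all add: FE_def FO_def)
  have T: "rep r L (\<lambda>g w. kE g w * f g w) (mul_kE (int r) p)"
    if "rep r L f p" "\<And>g k w. w \<in> L g k \<Longrightarrow> length w = 2 * k + r" for r L f p
  proof -
    have "rep r L (\<lambda>g w. (real g - 1) * (real g - 2) / 2 * ((real (length w) + 1) * f g w)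
        + (of_int 1 * real g + of_int (-2)) * f g w) (mul_kE (int r) p)"
      unfolding mul_kE_def by (intro rep_add rep_bchoose2 rep_blength rep_blinear that)
    then show ?thesis by (simp add: kE_def algebra_simps)
  qed
  have TE: "rep 0 LE (\<lambda>g w. kE g w * f g w) (mul_kE 0 p)" if "rep 0 LE f p" for f p
    using T[OF that] by (simp add: LE_def length_phase1)
  have TO: "rep 1 LO (\<lambda>g w. kE g w * f g w) (mul_kE 1 p)" if "rep 1 LO f p" for f p
    using T[OF that] by (simp add: LO_def length_phase1)
  have sE: "table_diff_correct 0 LE 0 2 kE i j l sE" unfolding sE_def by (rule table_diff_correct_stages[OF TE lowE])
  have sO: "table_diff_correct 1 LO 0 2 kE i j l sO" unfolding sO_def by (rule table_diff_correct_stages[OF TO lowO])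
  have W: "table_correct 0 LW (-1) 3 kW i j l w" unfolding w_def by (rule tabW_correct)
  have le: "gf (LE 2) (\<lambda>w. stat i j l (1 # w)) = gf (LE 2) (stat i j l) + Cat ^ 2 * yeval le"
    unfolding le_def using lower_terms_sum[of i j l 0 LE FE] lowE by (simp add: table_correct_def del: One_nat_def)
  have lo: "gf (LO 2) (\<lambda>w. stat i j l (1 # w)) = gf (LO 2) (stat i j l) + Cat ^ 3 * yeval lo"
    unfolding lo_def using lower_terms_sum[of i j l 1 LO FO] lowO
    by (simp add: table_correct_def del: One_nat_def)
  have stepE: "beval PE (Suc g) = beval PE g + beval dE (g + 2)" for g
    unfolding PE_def by (simp only: beval_base1 beval_integ) simp
  have stepO: "beval PO (Suc g) = beval PO g + beval dO (g + 2)" for g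
    unfolding PO_def by (simp only: beval_base1 beval_integ) simp
  have E1: "beval PE 1 = yeval e" and O1: "beval PO 1 = yeval e + yeval a"
    by (simp_all add: PE_def PO_def beval_base1)
  have E2: "beval PE 2 = yeval e + beval dE 3" and O2: "beval PO 2 = yeval e + yeval a + beval dO 3"
    using stepE[of 1] stepO[of 1] E1 O1 by (simp_all add: numeral_2_eq_2 numeral_3_eq_3)
  have ya: "yeval a = beval dE 3 + yeval le" by (simp only: a_def yeval_yadd ydot_1331)
  define s where "s = yeval a + (beval dO 3 + yeval lo)"
  have "yeval e = yy * (s + beval (tP w) 1) + beval (tP w) 1"
    by (simp only: e_def s_def w1_def yeval.simps yeval_yadd ydot_1331 ydot_11) (simp add: add.assoc)
  then have "yeval e * (1 - uu) = (yy * (1 - uu)) * s + (1 + yy) * (1 - uu) * beval (tP w) 1"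
    by (simp add: algebra_simps)
  then have "yeval e * (1 - uu) = uu * s + beval (tP w) 1" by (simp only: yy_uu yy_one_plus mult_1)
  (* the coupled equation for the value at g = 1, with the factor 1 - u removed again *)
  then have "yeval e = uu * (yeval e + s) + beval (tP w) 1" by (simp add: algebra_simps)
  then have bE: "beval PE 1 = uu * (beval PO 2 + yeval lo) + beval (tP w) 1" by (simp add: E1 O2 s_def add_ac del: One_nat_def)
  have bO: "beval PO 1 = beval PE 2 + yeval le" by (simp add: O1 E2 ya del: One_nat_def)
  have rE: "rep 0 LE (\<lambda>g w. fR 0 2 kE i j l g w - fP i j l g w) (tR sE)"
    and rO: "rep 1 LO (\<lambda>g w. fR 0 2 kE i j l g w - fP i j l g w) (tR sO)"
    and rW: "rep 0 LW (fR (-1) 3 kW i j l) (tR w)" and pW: "rep 0 LW (fP i j l) (tP w)"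
    using sE sO W unfolding table_diff_correct_def table_correct_def by blast+
  have sol: "gf (LE g) (stat i j l) = Cat ^ g * beval PE g \<and> gf (LO g) (stat i j l) = Cat ^ (g + 1) * beval PO g"
    if "1 \<le> g" for g
    by (rule EO_solution[OF rE rW rO pW le lo stepE[unfolded dE_def] stepO[unfolded dO_def] bE bO that])
  have "rep 0 LE (fP i j l) PE" "rep 1 LO (fP i j l) PO" using sol by (simp_all add: rep_def)
  then show ?case using table_correct_addP[OF sE] table_correct_addP[OF sO] by (simp add: moment_table)
qed

text \<open>The words of odd length with bound 1 are those to which \<open>sum_abacus\<close> reduces the cores.\<close>

lemma size_moment_series:
  "gf (LO 1) (\<lambda>w. word_size w ^ q) = Cat ^ 2 * yeval (ydot [1, 1] (tP (snd (tabEO q 0 0))))"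
proof -
  have "stat q 0 0 = (\<lambda>w. word_size w ^ q)" by (rule ext) (simp add: stat_def monomial_def)
  then show ?thesis using tabEO_correct[of q 0 0]
    by (simp add: table_correct_def rep_def ydot_11 numeral_2_eq_2)
qed

section \<open>Evaluation up to the fourth power\<close>

text \<open>The indices of the tables are successor terms, so that the recursion unfolds by its defining equations.\<close>

abbreviation "one \<equiv> Suc 0"
abbreviation "two \<equiv> Suc one"
abbreviation "three \<equiv> Suc two"
abbreviation "four \<equiv> Suc three"

text \<open>The computed entries of the tables, used as rewrite rules by all later entries.\<close>

named_theorems tabs

lemma share_weak_cong: "x = x' \<Longrightarrow> share x f = share x' f" by simp

lemmas poly_ops = yadd.simps yscale.simps ytheta_aux.simps badd.simps bscale.simps bshift.simps
  blinear_aux.simps blinear_def bchoose2_aux.simps bchoose2_def btheta_y.simps bmul_y.simps blength_def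
  bsolve_cons.simps bsolve.simps ydot.simps
lemmas table_ops = poly_ops binom.simps chain.simps share_def moment_table.sel stages_def addP.simps base0.simps integ_def
  finish_W_def mul_kW_def ysum_binom.simps lower_terms_def snd_coeff.simps base1_def finish_EO_def mul_kE_def nat.case fst_conv snd_conv
  add_Suc add_Suc_right add_0_left add_0_right diff_Suc_Suc diff_0 minus_nat.diff_0 diff_zero diff_0_eq_0
  arith_simps arith_special mult_1_left mult_1_right numeral_One inc.simps mult_minus1 mult_minus1_right minus_zero minus_minus

text \<open>The entries are computed in order of increasing weight; the right-hand sides are the normal forms found by
rewriting.\<close>

schematic_goal [tabs]: "tabW 0 0 0 = ?r"
  by (rule trans[OF tabW.simps], simp only: tabs table_ops cong: share_weak_cong)
schematic_goal [tabs]: "tabEO 0 0 0 = ?r"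
  by (rule trans[OF tabEO.simps], simp only: tabs table_ops cong: share_weak_cong)
schematic_goal [tabs]: "tabW 0 one 0 = ?r"
  by (rule trans[OF tabW.simps], simp only: tabs table_ops cong: share_weak_cong)
schematic_goal [tabs]: "tabEO 0 one 0 = ?r"
  by (rule trans[OF tabEO.simps], simp only: tabs table_ops cong: share_weak_cong)
schematic_goal [tabs]: "tabW 0 0 one = ?r"
  by (rule trans[OF tabW.simps], simp only: tabs table_ops cong: share_weak_cong)
schematic_goal [tabs]: "tabEO 0 0 one = ?r"
  by (rule trans[OF tabEO.simps], simp only: tabs table_ops cong: share_weak_cong)
schematic_goal [tabs]: "tabW 0 two 0 = ?r"
  by (rule trans[OF tabW.simps], simp only: tabs table_ops cong: share_weak_cong)
schematic_goal [tabs]: "tabEO 0 two 0 = ?r"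
  by (rule trans[OF tabEO.simps], simp only: tabs table_ops cong: share_weak_cong)
schematic_goal [tabs]: "tabW one 0 0 = ?r"
  by (rule trans[OF tabW.simps], simp only: tabs table_ops cong: share_weak_cong)
schematic_goal [tabs]: "tabEO one 0 0 = ?r"
  by (rule trans[OF tabEO.simps], simp only: tabs table_ops cong: share_weak_cong)
schematic_goal [tabs]: "tabW 0 one one = ?r"
  by (rule trans[OF tabW.simps], simp only: tabs table_ops cong: share_weak_cong)
schematic_goal [tabs]: "tabEO 0 one one = ?r"
  by (rule trans[OF tabEO.simps], simp only: tabs table_ops cong: share_weak_cong)
schematic_goal [tabs]: "tabW 0 0 two = ?r"
  by (rule trans[OF tabW.simps], simp only: tabs table_ops cong: share_weak_cong)
schematic_goal [tabs]: "tabEO 0 0 two = ?r"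
  by (rule trans[OF tabEO.simps], simp only: tabs table_ops cong: share_weak_cong)
schematic_goal [tabs]: "tabW 0 three 0 = ?r"
  by (rule trans[OF tabW.simps], simp only: tabs table_ops cong: share_weak_cong)
schematic_goal [tabs]: "tabEO 0 three 0 = ?r"
  by (rule trans[OF tabEO.simps], simp only: tabs table_ops cong: share_weak_cong)
schematic_goal [tabs]: "tabW one one 0 = ?r"
  by (rule trans[OF tabW.simps], simp only: tabs table_ops cong: share_weak_cong)
schematic_goal [tabs]: "tabEO one one 0 = ?r"
  by (rule trans[OF tabEO.simps], simp only: tabs table_ops cong: share_weak_cong)
schematic_goal [tabs]: "tabW 0 two one = ?r"
  by (rule trans[OF tabW.simps], simp only: tabs table_ops cong: share_weak_cong)
schematic_goal [tabs]: "tabEO 0 two one = ?r"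
  by (rule trans[OF tabEO.simps], simp only: tabs table_ops cong: share_weak_cong)
schematic_goal [tabs]: "tabW one 0 one = ?r"
  by (rule trans[OF tabW.simps], simp only: tabs table_ops cong: share_weak_cong)
schematic_goal [tabs]: "tabEO one 0 one = ?r"
  by (rule trans[OF tabEO.simps], simp only: tabs table_ops cong: share_weak_cong)
schematic_goal [tabs]: "tabW 0 one two = ?r"
  by (rule trans[OF tabW.simps], simp only: tabs table_ops cong: share_weak_cong)
schematic_goal [tabs]: "tabEO 0 one two = ?r"
  by (rule trans[OF tabEO.simps], simp only: tabs table_ops cong: share_weak_cong)
schematic_goal [tabs]: "tabW 0 0 three = ?r"
  by (rule trans[OF tabW.simps], simp only: tabs table_ops cong: share_weak_cong)
schematic_goal [tabs]: "tabEO 0 0 three = ?r"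
  by (rule trans[OF tabEO.simps], simp only: tabs table_ops cong: share_weak_cong)
schematic_goal [tabs]: "tabW 0 four 0 = ?r"
  by (rule trans[OF tabW.simps], simp only: tabs table_ops cong: share_weak_cong)
schematic_goal [tabs]: "tabEO 0 four 0 = ?r"
  by (rule trans[OF tabEO.simps], simp only: tabs table_ops cong: share_weak_cong)
schematic_goal [tabs]: "tabW one two 0 = ?r"
  by (rule trans[OF tabW.simps], simp only: tabs table_ops cong: share_weak_cong)
schematic_goal [tabs]: "tabEO one two 0 = ?r"
  by (rule trans[OF tabEO.simps], simp only: tabs table_ops cong: share_weak_cong)
schematic_goal [tabs]: "tabW two 0 0 = ?r"
  by (rule trans[OF tabW.simps], simp only: tabs table_ops cong: share_weak_cong)
schematic_goal [tabs]: "tabEO two 0 0 = ?r"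
  by (rule trans[OF tabEO.simps], simp only: tabs table_ops cong: share_weak_cong)
schematic_goal [tabs]: "tabW 0 three one = ?r"
  by (rule trans[OF tabW.simps], simp only: tabs table_ops cong: share_weak_cong)
schematic_goal [tabs]: "tabEO 0 three one = ?r"
  by (rule trans[OF tabEO.simps], simp only: tabs table_ops cong: share_weak_cong)
schematic_goal [tabs]: "tabW one one one = ?r"
  by (rule trans[OF tabW.simps], simp only: tabs table_ops cong: share_weak_cong)
schematic_goal [tabs]: "tabEO one one one = ?r"
  by (rule trans[OF tabEO.simps], simp only: tabs table_ops cong: share_weak_cong)
schematic_goal [tabs]: "tabW 0 two two = ?r"
  by (rule trans[OF tabW.simps], simp only: tabs table_ops cong: share_weak_cong)
schematic_goal [tabs]: "tabEO 0 two two = ?r"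
  by (rule trans[OF tabEO.simps], simp only: tabs table_ops cong: share_weak_cong)
schematic_goal [tabs]: "tabW one 0 two = ?r"
  by (rule trans[OF tabW.simps], simp only: tabs table_ops cong: share_weak_cong)
schematic_goal [tabs]: "tabEO one 0 two = ?r"
  by (rule trans[OF tabEO.simps], simp only: tabs table_ops cong: share_weak_cong)
schematic_goal [tabs]: "tabW 0 one three = ?r"
  by (rule trans[OF tabW.simps], simp only: tabs table_ops cong: share_weak_cong)
schematic_goal [tabs]: "tabEO 0 one three = ?r"
  by (rule trans[OF tabEO.simps], simp only: tabs table_ops cong: share_weak_cong)
schematic_goal [tabs]: "tabW one three 0 = ?r"
  by (rule trans[OF tabW.simps], simp only: tabs table_ops cong: share_weak_cong)
schematic_goal [tabs]: "tabEO one three 0 = ?r"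
  by (rule trans[OF tabEO.simps], simp only: tabs table_ops cong: share_weak_cong)
schematic_goal [tabs]: "tabW two one 0 = ?r"
  by (rule trans[OF tabW.simps], simp only: tabs table_ops cong: share_weak_cong)
schematic_goal [tabs]: "tabEO two one 0 = ?r"
  by (rule trans[OF tabEO.simps], simp only: tabs table_ops cong: share_weak_cong)
schematic_goal [tabs]: "tabW 0 0 four = ?r"
  by (rule trans[OF tabW.simps], simp only: tabs table_ops cong: share_weak_cong)
schematic_goal [tabs]: "tabEO 0 0 four = ?r"
  by (rule trans[OF tabEO.simps], simp only: tabs table_ops cong: share_weak_cong)
schematic_goal [tabs]: "tabW one two one = ?r"
  by (rule trans[OF tabW.simps], simp only: tabs table_ops cong: share_weak_cong)
schematic_goal [tabs]: "tabEO one two one = ?r"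
  by (rule trans[OF tabEO.simps], simp only: tabs table_ops cong: share_weak_cong)
schematic_goal [tabs]: "tabW two 0 one = ?r"
  by (rule trans[OF tabW.simps], simp only: tabs table_ops cong: share_weak_cong)
schematic_goal [tabs]: "tabEO two 0 one = ?r"
  by (rule trans[OF tabEO.simps], simp only: tabs table_ops cong: share_weak_cong)
schematic_goal [tabs]: "tabW one one two = ?r"
  by (rule trans[OF tabW.simps], simp only: tabs table_ops cong: share_weak_cong)
schematic_goal [tabs]: "tabEO one one two = ?r"
  by (rule trans[OF tabEO.simps], simp only: tabs table_ops cong: share_weak_cong)
schematic_goal [tabs]: "tabW one 0 three = ?r"
  by (rule trans[OF tabW.simps], simp only: tabs table_ops cong: share_weak_cong)
schematic_goal [tabs]: "tabEO one 0 three = ?r"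
  by (rule trans[OF tabEO.simps], simp only: tabs table_ops cong: share_weak_cong)
schematic_goal [tabs]: "tabW two two 0 = ?r"
  by (rule trans[OF tabW.simps], simp only: tabs table_ops cong: share_weak_cong)
schematic_goal [tabs]: "tabEO two two 0 = ?r"
  by (rule trans[OF tabEO.simps], simp only: tabs table_ops cong: share_weak_cong)
schematic_goal [tabs]: "tabW three 0 0 = ?r"
  by (rule trans[OF tabW.simps], simp only: tabs table_ops cong: share_weak_cong)
schematic_goal [tabs]: "tabEO three 0 0 = ?r"
  by (rule trans[OF tabEO.simps], simp only: tabs table_ops cong: share_weak_cong)
schematic_goal [tabs]: "tabW two one one = ?r"
  by (rule trans[OF tabW.simps], simp only: tabs table_ops cong: share_weak_cong)
schematic_goal [tabs]: "tabEO two one one = ?r"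
  by (rule trans[OF tabEO.simps], simp only: tabs table_ops cong: share_weak_cong)
schematic_goal [tabs]: "tabW two 0 two = ?r"
  by (rule trans[OF tabW.simps], simp only: tabs table_ops cong: share_weak_cong)
schematic_goal [tabs]: "tabEO two 0 two = ?r"
  by (rule trans[OF tabEO.simps], simp only: tabs table_ops cong: share_weak_cong)
schematic_goal [tabs]: "tabW three one 0 = ?r"
  by (rule trans[OF tabW.simps], simp only: tabs table_ops cong: share_weak_cong)
schematic_goal [tabs]: "tabEO three one 0 = ?r"
  by (rule trans[OF tabEO.simps], simp only: tabs table_ops cong: share_weak_cong)
schematic_goal [tabs]: "tabW three 0 one = ?r"
  by (rule trans[OF tabW.simps], simp only: tabs table_ops cong: share_weak_cong)
schematic_goal [tabs]: "tabEO three 0 one = ?r"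
  by (rule trans[OF tabEO.simps], simp only: tabs table_ops cong: share_weak_cong)
schematic_goal [tabs]: "tabW four 0 0 = ?r"
  by (rule trans[OF tabW.simps], simp only: tabs table_ops cong: share_weak_cong)
schematic_goal [tabs]: "tabEO four 0 0 = ?r"
  by (rule trans[OF tabEO.simps], simp only: tabs table_ops cong: share_weak_cong)

section \<open>From the generating function to the moments\<close>

text \<open>The series \<open>x / (1 - 4x)\<close> and \<open>1 / (1 - 4x)\<close>, see \<open>ww_eq\<close> and \<open>tau_sq_eq\<close>.\<close>

definition ww :: "real fps" where "ww = yy + yy ^ 2"
definition tau_sq :: "real fps" where "tau_sq = (Cat * (1 + yy)) ^ 2"

lemma ww_eq: "ww = fps_X * tau_sq"
proof -
  have u: "uu * (1 + yy) = yy" using yy_uu by (simp add: algebra_simps)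
  have "fps_X * tau_sq = uu * (1 + yy) ^ 2" by (simp add: tau_sq_def power_mult_distrib X_Cat[symmetric] mult.assoc)
  also have "\<dots> = (uu * (1 + yy)) * (1 + yy)" by (simp add: power2_eq_square mult.assoc)
  also have "\<dots> = ww" unfolding u by (simp add: ww_def power2_eq_square algebra_simps)
  finally show ?thesis by simp
qed

text \<open>From \<open>C = 1 + u = (1 + 2y)(1 - u)\<close> follows \<open>C (1 + y) = 1 + 2y\<close>, whose square is \<open>1 + 4 (y + y\<^sup>2)\<close>.\<close>

lemma tau_sq_eq: "(1 - 4 * fps_X) * tau_sq = 1"
proof -
  have "(1 + 2 * yy) * (1 - uu) = (1 - uu) + 2 * (yy * (1 - uu))" by (simp add: algebra_simps)
  also have "\<dots> = Cat" unfolding yy_uu by (simp add: uu_def)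
  finally have c: "Cat = (1 + 2 * yy) * (1 - uu)" by simp
  have "Cat * (1 + yy) = (1 + 2 * yy) * ((1 + yy) * (1 - uu))" by (subst c) (simp only: ac_simps)
  then have "tau_sq = (1 + 2 * yy) ^ 2" by (simp add: tau_sq_def yy_one_plus)
  also have "\<dots> = 1 + 4 * ww" by (simp add: ww_def power2_eq_square algebra_simps)
  finally have "tau_sq = 1 + 4 * (fps_X * tau_sq)" by (simp add: ww_eq)
  then show ?thesis by (simp add: algebra_simps)
qed

lemma tau_sq_step: "fps_nth (tau_sq * F) (Suc n) = 4 * fps_nth (tau_sq * F) n + fps_nth F (Suc n)"
proof -
  have "tau_sq * F = 4 * fps_X * tau_sq * F + (1 - 4 * fps_X) * tau_sq * F" by (simp add: algebra_simps)
  also have "\<dots> = fps_X * (fps_const 4 * (tau_sq * F)) + F" unfolding tau_sq_eq by (simp add: numeral_fps_const ac_simps)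
  finally have "fps_nth (tau_sq * F) (Suc n) = fps_nth (fps_X * (fps_const 4 * (tau_sq * F)) + F) (Suc n)" by (rule arg_cong)
  then show ?thesis by simp
qed

lemma tau_sq_nth_0: "fps_nth tau_sq 0 = 1"
  using arg_cong[OF tau_sq_eq, of "\<lambda>F. fps_nth F 0"] by simp

text \<open>Each further factor \<open>x / (1 - 4x)\<close> turns the coefficients into partial sums scaled by powers of 4; this
is Pascal's rule.\<close>

lemma nth_tau_sq_ww_power: "fps_nth (tau_sq * ww ^ j) n = 4 ^ n * real (n choose j) / 4 ^ j"
proof (induction j arbitrary: n)
  case 0
  show ?case by (induction n) (use tau_sq_step[of 1] tau_sq_nth_0 in simp_all)
next
  case (Suc j)
  note IH = Suc
  have w: "ww ^ Suc j = fps_X * (tau_sq * ww ^ j)" by (simp add: ww_eq mult.assoc)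
  show ?case
  proof (induction n)
    case 0
    show ?case unfolding w by simp
  next
    case (Suc n)
    have "fps_nth (ww ^ Suc j) (Suc n) = fps_nth (tau_sq * ww ^ j) n" unfolding w by simp
    then have "fps_nth (tau_sq * ww ^ Suc j) (Suc n) = 4 * fps_nth (tau_sq * ww ^ Suc j) n + fps_nth (tau_sq * ww ^ j) n"
      by (simp only: tau_sq_step)
    then show ?case by (simp only: Suc IH) (simp add: field_simps)
  qed
qed

text \<open>Multiplication by \<open>y + y\<^sup>2\<close>, substitution of \<open>y + y\<^sup>2\<close> and multiplication by \<open>(1 + y)\<^sup>2\<close>.  The empty
list is kept empty so that no trailing zeros arise and the numerators can be compared as lists.\<close>

fun ymul_w :: "ypoly \<Rightarrow> ypoly" where
  "ymul_w [] = []"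
| "ymul_w (x # a) = 0 # yadd (x # a) (0 # x # a)"

lemma yeval_ymul_w: "yeval (ymul_w a) = ww * yeval a"
  by (cases a) (simp_all add: ww_def algebra_simps power2_eq_square)

fun ysubst :: "int list \<Rightarrow> ypoly" where
  "ysubst [] = []"
| "ysubst (m # ms) = yadd [m] (ymul_w (ysubst ms))"

fun ymul_sq :: "ypoly \<Rightarrow> ypoly" where "ymul_sq a = yadd a (yadd (0 # yscale 2 a) (0 # 0 # a))"

text \<open>The sum over \<open>i\<close> of \<open>m\<^sub>i / 4\<^sup>i\<close> times the binomial coefficient of \<open>x\<close> over \<open>i\<close>, in nested form and started at
index \<open>j\<close>.\<close>

fun newton :: "nat \<Rightarrow> real \<Rightarrow> int list \<Rightarrow> real" where
  "newton j x [] = 0"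
| "newton j x (m # ms) = of_int m + (x - real j) / (4 * real (Suc j)) * newton (Suc j) x ms"

lemma nth_tau_sq_ysubst: "fps_nth (tau_sq * ww ^ j * yeval (ysubst ms)) n = 4 ^ n * real (n choose j) / 4 ^ j * newton j (real n) ms"
proof (induction ms arbitrary: j)
  case (Cons m ms)
  have b: "real (n choose Suc j) = real (n choose j) * (real n - real j) / real (Suc j)"
  proof (cases "j \<le> n")
    case True
    have "Suc j * (n choose Suc j) = (n - j) * (n choose j)"
      by (metis binomial_absorb_comp binomial_absorption mult.commute)
    then have "real (Suc j) * real (n choose Suc j) = (real n - real j) * real (n choose j)"
      using True by (metis of_nat_diff of_nat_mult)
    then show ?thesis by (simp add: field_simps del: of_nat_Suc)
  qed (simp add: binomial_eq_0)
  have "yeval (ysubst (m # ms)) = of_int m + ww * yeval (ysubst ms)"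
    by (simp add: yeval_ymul_w)
  then have "tau_sq * ww ^ j * yeval (ysubst (m # ms)) = fps_const (of_int m) * (tau_sq * ww ^ j) + tau_sq * ww ^ Suc j * yeval (ysubst ms)"
    by (simp add: fps_const_of_int algebra_simps)
  then show ?case
    by (simp only: fps_add_nth fps_mult_left_const_nth nth_tau_sq_ww_power Cons.IH b newton.simps)
       (simp add: field_simps del: of_nat_Suc)
qed simp

lemma moment_sum:
  assumes n: "1 \<le> n" and k: "k = q" and N: "ydot [1, 1] (tP (snd (tabEO q 0 0))) = ymul_sq (ysubst ms)"
  shows "(\<Sum>xs\<in>distinct_cores (2 * n + 1) (2 * n + 3). real (sum_list xs) ^ k) = 4 ^ n * newton 0 (real n) ms"
proof -
  have s: "2 * n + 3 = (2 * n + 1) + 2" "3 \<le> 2 * n + 1" using n by simp_all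
  have "(\<Sum>xs\<in>distinct_cores (2 * n + 1) (2 * n + 3). real (sum_list xs) ^ k) = (\<Sum>w\<in>phase1 (2 * n + 1) 1. word_size w ^ q)"
    unfolding s(1) k using sum_distinct_cores[OF s(2)] sum_abacus[OF n] by simp
  also have "\<dots> = fps_nth (gf (LO 1) (\<lambda>w. word_size w ^ q)) n" by (simp add: gf_def LO_def)
  also have "gf (LO 1) (\<lambda>w. word_size w ^ q) = tau_sq * ww ^ 0 * yeval (ysubst ms)"
    unfolding size_moment_series N by (simp add: tau_sq_def power_mult_distrib power2_eq_square algebra_simps)
  finally show ?thesis unfolding nth_tau_sq_ysubst by simp
qed

text \<open>The lists on the right are found by dividing the computed numerators by \<open>(1 + y)\<^sup>2\<close> and expanding in powers
of \<open>y + y\<^sup>2\<close>.\<close>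

lemma numerator_0: "ydot [1, 1] (tP (snd (tabEO 0 0 0))) = ymul_sq (ysubst [1])"
  by (simp only: tabs table_ops ymul_sq.simps ysubst.simps ymul_w.simps)

lemma numerator_1: "ydot [1, 1] (tP (snd (tabEO one 0 0))) = ymul_sq (ysubst [0, 7, 57, 120])"
  by (simp only: tabs table_ops ymul_sq.simps ysubst.simps ymul_w.simps)

lemma numerator_2: "ydot [1, 1] (tP (snd (tabEO two 0 0))) = ymul_sq (ysubst [0, 21, 1127, 18066, 124966,
      394376, 467328])"
  by (simp only: tabs table_ops ymul_sq.simps ysubst.simps ymul_w.simps)

lemma numerator_3: "ydot [1, 1] (tP (snd (tabEO three 0 0))) = ymul_sq (ysubst [0, 73, 18345, 1007382,
      22908396, 268790064, 1774626810, 6672588984, 13359093600, 11068551936])"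
  by (simp only: tabs table_ops ymul_sq.simps ysubst.simps ymul_w.simps)

lemma numerator_4: "ydot [1, 1] (tP (snd (tabEO four 0 0))) = ymul_sq (ysubst [0, 273, 314975, 51417294,
      2978027854, 84738498416, 1380095626020, 13909574000736, 89906458270200, 373965148493376,
      969198305933952, 1425574671403008, 909711199272960])"
  by (simp only: tabs table_ops ymul_sq.simps ysubst.simps ymul_w.simps)

text \<open>The first four moments about the origin as polynomials in \<open>n\<close>.\<close>

lemma newton_1: "newton 0 x [0, 7, 57, 120] =
    (10 * x ^ 3 + 27 * x ^ 2 + 19 * x) / 32"
  by (simp add: algebra_simps power_numeral_reduce add_divide_distrib diff_divide_distrib)

lemma newton_2: "newton 0 x [0, 21, 1127, 18066, 124966, 394376, 467328] =
    (2434 * x ^ 6 + 12787 * x ^ 5 + 26335 * x ^ 4 + 25895 * x ^ 3 + 11671 * x ^ 2 + 1518 * x) / 15360"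
  by (simp add: algebra_simps power_numeral_reduce add_divide_distrib diff_divide_distrib)

lemma newton_3: "newton 0 x [0, 73, 18345, 1007382, 22908396, 268790064, 1774626810, 6672588984,
      13359093600, 11068551936] =
    (3202706 * x ^ 9 + 23859809 * x ^ 8 + 76471504 * x ^ 7 + 136212706 * x ^ 6 + 144964330 * x ^ 5 +
      90557761 * x ^ 4 + 27859556 * x ^ 3 + 502844 * x ^ 2 - 1297776 * x) / 27525120"
  by (simp add: algebra_simps power_numeral_reduce add_divide_distrib diff_divide_distrib)

lemma newton_4: "newton 0 x [0, 273, 314975, 51417294, 2978027854, 84738498416, 1380095626020,
      13909574000736, 89906458270200, 373965148493376, 969198305933952, 1425574671403008, 909711199272960] =
    (12338747820 * x ^ 12 + 113751153908 * x ^ 11 + 469614640693 * x ^ 10 + 1140883363235 * x ^ 9 +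
      1800864051360 * x ^ 8 + 1915174056114 * x ^ 7 + 1353471716289 * x ^ 6 + 570137455195 * x ^ 5 +
      80479189670 * x ^ 4 - 28863021572 * x ^ 3 + 3091551768 * x ^ 2 + 8271277920 * x) / 108999475200"
  by (simp add: algebra_simps power_numeral_reduce add_divide_distrib diff_divide_distrib)

text \<open>A common denominator of the four products is 435997900800, which is 8 times the denominator in the
result.\<close>

lemma central_moment_polynomial:
  fixes x :: real
  defines "m1 \<equiv> newton 0 x [0, 7, 57, 120]"
    and "m2 \<equiv> newton 0 x [0, 21, 1127, 18066, 124966, 394376, 467328]"
    and "m3 \<equiv> newton 0 x [0, 73, 18345, 1007382, 22908396, 268790064, 1774626810, 6672588984,
      13359093600, 11068551936]"
    and "m4 \<equiv> newton 0 x [0, 273, 314975, 51417294, 2978027854, 84738498416, 1380095626020,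
      13909574000736, 89906458270200, 373965148493376, 969198305933952, 1425574671403008, 909711199272960]"
  shows "m4 - 4 * m1 * m3 + 6 * m1 ^ 2 * m2 - 3 * m1 ^ 4 =
    (1 / 54499737600) *
      (1743712560 * x ^ 12 + 13490284234 * x ^ 11 + 45408125279 * x ^ 10
       + 87568584895 * x ^ 9 + 109173019890 * x ^ 8 + 97494786972 * x ^ 7
       + 68082466947 * x ^ 6 + 34594762895 * x ^ 5 + 8734303600 * x ^ 4
       + 3269131844 * x ^ 3 + 7648567524 * x ^ 2 + 4135638960 * x)"
proof -
  define a1 where "a1 = 10 * x ^ 3 + 27 * x ^ 2 + 19 * x"
  define a2 where "a2 = 2434 * x ^ 6 + 12787 * x ^ 5 + 26335 * x ^ 4 + 25895 * x ^ 3 + 11671 * x ^ 2 + 1518 * x"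
  define a3 where "a3 = 3202706 * x ^ 9 + 23859809 * x ^ 8 + 76471504 * x ^ 7 + 136212706 * x ^ 6 +
    144964330 * x ^ 5 + 90557761 * x ^ 4 + 27859556 * x ^ 3 + 502844 * x ^ 2 - 1297776 * x"
  define a4 where "a4 = 12338747820 * x ^ 12 + 113751153908 * x ^ 11 + 469614640693 * x ^ 10 + 1140883363235
    * x ^ 9 + 1800864051360 * x ^ 8 + 1915174056114 * x ^ 7 + 1353471716289 * x ^ 6 + 570137455195 * x ^ 5 +
    80479189670 * x ^ 4 - 28863021572 * x ^ 3 + 3091551768 * x ^ 2 + 8271277920 * x"
  have "m4 - 4 * m1 * m3 + 6 * m1 ^ 2 * m2 - 3 * m1 ^ 4 =
      (4 * a4 - 1980 * a1 * a3 + 166320 * a1 ^ 2 * a2 - 1247400 * a1 ^ 4) / 435997900800"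
    unfolding m1_def m2_def m3_def m4_def newton_1 newton_2 newton_3 newton_4
      a1_def[symmetric] a2_def[symmetric] a3_def[symmetric] a4_def[symmetric]
    by (simp add: power_divide diff_divide_distrib add_divide_distrib)
  moreover have "4 * a4 - 1980 * a1 * a3 + 166320 * a1 ^ 2 * a2 - 1247400 * a1 ^ 4 = 8 * (1743712560 * x ^
    12 + 13490284234 * x ^ 11 + 45408125279 * x ^ 10
       + 87568584895 * x ^ 9 + 109173019890 * x ^ 8 + 97494786972 * x ^ 7
       + 68082466947 * x ^ 6 + 34594762895 * x ^ 5 + 8734303600 * x ^ 4
       + 3269131844 * x ^ 3 + 7648567524 * x ^ 2 + 4135638960 * x)"
    unfolding a1_def a2_def a3_def a4_def by algebra
  ultimately show ?thesis by simp
qed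

lemma fourth_central_moment:
  fixes f :: "'a \<Rightarrow> real"
  assumes "finite A" "A \<noteq> {}"
    and m: "m1 = mean_on A f" "m2 = mean_on A (\<lambda>x. f x ^ 2)" "m3 = mean_on A (\<lambda>x. f x ^ 3)"
      "m4 = mean_on A (\<lambda>x. f x ^ 4)"
  shows "central_moment 4 A f = m4 - 4 * m1 * m3 + 6 * m1 ^ 2 * m2 - 3 * m1 ^ 4"
proof -
  let ?c = "real (card A)"
  have c: "?c \<noteq> 0" using assms(1,2) by simp
  have s: "(\<Sum>x\<in>A. f x) = ?c * m1" "(\<Sum>x\<in>A. f x ^ 2) = ?c * m2" "(\<Sum>x\<in>A. f x ^ 3) =
    ?c * m3"
    "(\<Sum>x\<in>A. f x ^ 4) = ?c * m4"
    using c by (simp_all add: m mean_on_def)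
  have "(\<Sum>x\<in>A. (f x - m1) ^ 4) =
      (\<Sum>x\<in>A. f x ^ 4 - 4 * m1 * f x ^ 3 + 6 * m1 ^ 2 * f x ^ 2 - 4 * m1 ^ 3 * f x + m1 ^ 4)"
    by (rule sum.cong) (simp_all add: power4_eq_xxxx power3_eq_cube power2_eq_square algebra_simps)
  also have "\<dots> = (\<Sum>x\<in>A. f x ^ 4) - 4 * m1 * (\<Sum>x\<in>A. f x ^ 3) + 6 * m1 ^ 2 *
    (\<Sum>x\<in>A. f x ^ 2)
      - 4 * m1 ^ 3 * (\<Sum>x\<in>A. f x) + ?c * m1 ^ 4"
    by (simp add: sum.distrib sum_subtractf sum_distrib_left)
  also have "\<dots> = ?c * (m4 - 4 * m1 * m3 + 6 * m1 ^ 2 * m2 - 3 * m1 ^ 4)"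
    unfolding s by (simp add: algebra_simps power4_eq_xxxx power3_eq_cube)
  finally show ?thesis using c by (simp add: central_moment_def m(1))
qed

theorem theorem4:
  fixes n :: nat
  assumes "n \<ge> 1"
  shows "central_moment 4 (distinct_cores (2 * n + 1) (2 * n + 3)) (\<lambda>xs. real (sum_list xs)) =
    (1 / 54499737600) *
      (1743712560 * real n ^ 12 + 13490284234 * real n ^ 11 + 45408125279 * real n ^ 10
       + 87568584895 * real n ^ 9 + 109173019890 * real n ^ 8 + 97494786972 * real n ^ 7
       + 68082466947 * real n ^ 6 + 34594762895 * real n ^ 5 + 8734303600 * real n ^ 4
       + 3269131844 * real n ^ 3 + 7648567524 * real n ^ 2 + 4135638960 * real n)"
proof -
  let ?D = "distinct_cores (2 * n + 1) (2 * n + 3)"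
  note moment = moment_sum[OF assms]
  have "(\<Sum>xs\<in>?D. real (sum_list xs) ^ 0) = 4 ^ n * newton 0 (real n) [1]"
    by (rule moment[OF _ numerator_0]) simp
  then have card: "real (card ?D) = 4 ^ n" by simp
  then have D: "finite ?D" "?D \<noteq> {}" using card_ge_0_finite[of ?D] by (auto simp: card_gt_0_iff)
  have mean: "mean_on ?D (\<lambda>xs. real (sum_list xs) ^ k) = newton 0 (real n) ms"
    if "(\<Sum>xs\<in>?D. real (sum_list xs) ^ k) = 4 ^ n * newton 0 (real n) ms" for k ms
    unfolding mean_on_def card that by simp
  have m1: "newton 0 (real n) [0, 7, 57, 120] = mean_on ?D (\<lambda>xs. real (sum_list xs))"
    using mean[OF moment[OF _ numerator_1, of 1]] by simp
  have m2: "newton 0 (real n) [0, 21, 1127, 18066, 124966, 394376, 467328] = mean_on ?D (\<lambda>xs. real (sum_list xs) ^ 2)"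
    by (rule mean[OF moment[OF _ numerator_2], symmetric]) simp
  have m3: "newton 0 (real n) [0, 73, 18345, 1007382, 22908396, 268790064, 1774626810, 6672588984, 13359093600, 11068551936] = mean_on ?D (\<lambda>xs. real (sum_list xs) ^ 3)"
    by (rule mean[OF moment[OF _ numerator_3], symmetric]) simp
  have m4: "newton 0 (real n) [0, 273, 314975, 51417294, 2978027854, 84738498416, 1380095626020, 13909574000736, 89906458270200, 373965148493376, 969198305933952, 1425574671403008, 909711199272960] = mean_on ?D (\<lambda>xs. real (sum_list xs) ^ 4)"
    by (rule mean[OF moment[OF _ numerator_4], symmetric]) simp
  show ?thesis
    unfolding fourth_central_moment[OF D m1 m2 m3 m4] by (rule central_moment_polynomial)
qed

end
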